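(* Let $q\ge 2$ be an integer and let $\Gamma$ be a graph. Then $\Gamma$ is a strongly regular graph with parameters $(q^3+q^2+q+1,\,q^2+q,\,q-1,\,q+1)$ having a regular point if and only if $\Gamma$ is (isomorphic to) $\Gamma(\mathcal{H},\mathcal{I},\phi)$ for some $\mathcal{H},\mathcal{I},\phi$ such that (i) $\mathcal{H}$ is a distance-regular graph with intersection array $\{q^2-1,q^2-q,1;1,q,q^2-1\}$; (ii) $\mathcal{I}$ is an affine plane of order $q$; (iii) $\phi$ is a bijection from the fibres of $\mathcal{H}$ to the points of $\mathcal{I}$.
   Context: All graphs are finite, simple and undirected. A strongly regular graph with parameters $(\nu,k,\lambda,\mu)$ is a $k$-regular graph on $\nu$ vertices in which any two adjacent vertices have exactly $\lambda$ common neighbours and any two distinct non-adjacent vertices have exactly $\mu$ common neighbours. For a vertex $v$ of $\Gamma$, $\Gamma_2(v)$ denotes the graph induced on the vertices at distance $2$ from $v$. A distance-regular graph with intersection array $\{q^2-1,q^2-q,1;1,q,q^2-1\}$ is an antipodal $q$-cover of the complete graph $K_{q^2}$; its fibres are its antipodal classes (the classes of the equivalence relation "equal or at distance $3$"); there are $q^2$ fibres, each of size $q$. Regular point. A vertex $v$ of a strongly regular graph $\Gamma$ with parameters $(q^3+q^2+q+1,q^2+q,q-1,q+1)$ is a regular point if $\Gamma_2(v)$ generates a $3$-class association scheme with relations $I,B_1,B_2,B_3$, where $B_1$ is the adjacency matrix of $\Gamma_2(v)$, and with first eigenmatrix (columns indexed by the relations in this order, rows by the eigenspaces in some order) $$\begin{bmatrix}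 1 & q^2-1 & (q-1)(q^2-1) & q-1\\ 1 & q-1 & 1-q & -1\\ 1 & -1 & 1-q & q-1\\ 1 & -q-1 & q+1 & -1\end{bmatrix};$$ equivalently, $\Gamma_2(v)$ is a distance-regular antipodal $q$-cover of $K_{q^2}$ with intersection array $\{q^2-1,q^2-q,1;1,q,q^2-1\}$. The graph $\Gamma(\mathcal{H},\mathcal{I},\phi)$. Given such a distance-regular graph $\mathcal{H}$ with vertex set $V(\mathcal{H})$, an affine plane $\mathcal{I}$ of order $q$ with point set $\mathcal{P}$ and line set $\mathcal{L}$, and a bijection $\phi$ from the fibres of $\mathcal{H}$ to $\mathcal{P}$, the graph $\Gamma(\mathcal{H},\mathcal{I},\phi)$ has vertex set $\{v\}\cup\mathcal{L}\cup V(\mathcal{H})$ (disjoint union, $v$ a new vertex), with adjacencies: $v$ is adjacent to all lines in $\mathcal{L}$ and to nothing else; two distinct lines are adjacent if they are parallel; a line $\ell\in\mathcal{L}$ is adjacent to a vertex of $V(\mathcal{H})$ lying in the fibre $W$ if and only if $\phi(W)$ is incident with $\ell$; two vertices of $V(\mathcal{H})$ are adjacent if they are adjacent in $\mathcal{H}$. *)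

theory Defs
  imports
    Complex_Main
    "HOL-Library.Infinite_Typeclass"
    "Graph_Theory.Graph_Theory"
begin

section \<open>Graphs\<close>

text \<open>
  A finite simple undirected graph is a \<^locale>\<open>pair_graph\<close>: an edge is stored as both of its
  orientations, so the neighbourhood of \<open>u\<close> is \<open>parcs G `` {u}\<close>.
\<close>

definition strongly_regular :: "'a pair_pre_digraph \<Rightarrow> nat \<Rightarrow> nat \<Rightarrow> nat \<Rightarrow> nat \<Rightarrow> bool" where
  "strongly_regular G n k l m \<longleftrightarrow>
     pair_graph G \<and> card (pverts G) = n \<and>
     (\<forall>u\<in>pverts G. card (parcs G `` {u}) = k) \<and>
     (\<forall>u\<in>pverts G. \<forall>w\<in>pverts G. (u, w) \<in> parcs G \<longrightarrow>
        card (parcs G `` {u} \<inter> parcs G `` {w}) = l) \<and>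
     (\<forall>u\<in>pverts G. \<forall>w\<in>pverts G. u \<noteq> w \<and> (u, w) \<notin> parcs G \<longrightarrow>
        card (parcs G `` {u} \<inter> parcs G `` {w}) = m)"

text \<open>The value is \<open>\<infinity>\<close> if there is no walk between the two vertices.\<close>

definition gdist :: "'a pair_pre_digraph \<Rightarrow> 'a \<Rightarrow> 'a \<Rightarrow> ereal" where
  "gdist G u w = wf_digraph.\<mu> (with_proj G) (\<lambda>_. 1) u w"

definition diameter :: "'a pair_pre_digraph \<Rightarrow> ereal" where
  "diameter G = (SUP (u, w) \<in> pverts G \<times> pverts G. gdist G u w)"

definition second_subconstituent :: "'a pair_pre_digraph \<Rightarrow> 'a \<Rightarrow> 'a pair_pre_digraph" where
  "second_subconstituent G v =
     (let S = {u \<in> pverts G. gdist G v u = 2} in \<lparr>pverts = S, parcs = parcs G \<inter> S \<times> S\<rparr>)"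

text \<open>
  For an intersection array \<open>{b\<^sub>0, \<dots>, b\<^bsub>d-1\<^esub>; c\<^sub>1, \<dots>, c\<^sub>d}\<close> the two lists are
  \<open>[b\<^sub>0, \<dots>, b\<^bsub>d-1\<^esub>]\<close> and \<open>[c\<^sub>1, \<dots>, c\<^sub>d]\<close>; thus \<open>cs ! i\<close> is \<open>c\<^bsub>i+1\<^esub>\<close>.
\<close>

definition distance_regular :: "'a pair_pre_digraph \<Rightarrow> nat list \<Rightarrow> nat list \<Rightarrow> bool" where
  "distance_regular G bs cs \<longleftrightarrow>
     pair_graph G \<and> Digraph_Component.connected (with_proj G) \<and>
     length cs = length bs \<and> diameter G = ereal (real (length bs)) \<and>
     (\<forall>u\<in>pverts G. \<forall>w\<in>pverts G. \<forall>i<length bs.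
        (gdist G u w = ereal (real i) \<longrightarrow>
           card {z \<in> parcs G `` {w}. gdist G u z = ereal (real (i + 1))} = bs ! i) \<and>
        (gdist G u w = ereal (real (i + 1)) \<longrightarrow>
           card {z \<in> parcs G `` {w}. gdist G u z = ereal (real i)} = cs ! i))"

definition antipodal_rel :: "'a pair_pre_digraph \<Rightarrow> 'a rel" where
  "antipodal_rel H = {(x, y) \<in> pverts H \<times> pverts H. x = y \<or> gdist H x y = 3}"

definition fibres :: "'a pair_pre_digraph \<Rightarrow> 'a set set" where
  "fibres H = pverts H // antipodal_rel H"


section \<open>Symmetric association schemes\<close>

text \<open>
  Real matrices whose rows and columns are indexed by a finite set \<open>X\<close>. All matrices below vanish
  outside \<open>X \<times> X\<close>, so equality of functions is equality of matrices.
\<close>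

type_synonym 'a sqmat = "'a \<Rightarrow> 'a \<Rightarrow> real"

definition rel_mat :: "'a rel \<Rightarrow> 'a sqmat" where
  "rel_mat r = (\<lambda>x y. of_bool ((x, y) \<in> r))"

definition mat_mult :: "'a set \<Rightarrow> 'a sqmat \<Rightarrow> 'a sqmat \<Rightarrow> 'a sqmat" where
  "mat_mult X A B = (\<lambda>x y. \<Sum>z\<in>X. A x z * B z y)"

primrec mat_pow :: "'a set \<Rightarrow> 'a sqmat \<Rightarrow> nat \<Rightarrow> 'a sqmat" where
  "mat_pow X A 0 = rel_mat (Id_on X)"
| "mat_pow X A (Suc n) = mat_mult X (mat_pow X A n) A"

definition lin_comb :: "nat set \<Rightarrow> (nat \<Rightarrow> real) \<Rightarrow> (nat \<Rightarrow> 'a sqmat) \<Rightarrow> 'a sqmat" where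
  "lin_comb J c M = (\<lambda>x y. \<Sum>j\<in>J. c j * M j x y)"

definition assoc_scheme :: "'a set \<Rightarrow> nat \<Rightarrow> (nat \<Rightarrow> 'a rel) \<Rightarrow> bool" where
  "assoc_scheme X d R \<longleftrightarrow>
     finite X \<and> R 0 = Id_on X \<and>
     (\<forall>i\<le>d. R i \<noteq> {} \<and> sym (R i)) \<and>
     (\<Union>i\<le>d. R i) = X \<times> X \<and>
     (\<forall>i\<le>d. \<forall>j\<le>d. i \<noteq> j \<longrightarrow> R i \<inter> R j = {}) \<and>
     (\<exists>p :: nat \<Rightarrow> nat \<Rightarrow> nat \<Rightarrow> nat. \<forall>i\<le>d. \<forall>j\<le>d. \<forall>k\<le>d. \<forall>(x, y)\<in>R k.
        card {z \<in> X. (x, z) \<in> R i \<and> (z, y) \<in> R j} = p i j k)"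

definition bose_mesner :: "nat \<Rightarrow> (nat \<Rightarrow> 'a rel) \<Rightarrow> 'a sqmat set" where
  "bose_mesner d R = {lin_comb {..d} c (\<lambda>j. rel_mat (R j)) |c. True}"

text \<open>The right-hand side is the algebra of all polynomials in \<open>A\<close>.\<close>

definition generates_scheme :: "'a sqmat \<Rightarrow> 'a set \<Rightarrow> nat \<Rightarrow> (nat \<Rightarrow> 'a rel) \<Rightarrow> bool" where
  "generates_scheme A X d R \<longleftrightarrow>
     assoc_scheme X d R \<and> bose_mesner d R = {lin_comb {..<n} c (mat_pow X A) |c n. True}"

text \<open>
  The Bose-Mesner algebra has dimension \<open>d + 1\<close>, so \<open>d + 1\<close> nonzero mutually orthogonal idempotents
  in it are its primitive idempotents, i.e. the projections onto the common eigenspaces.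
\<close>

definition primitive_idempotents ::
    "'a set \<Rightarrow> nat \<Rightarrow> (nat \<Rightarrow> 'a rel) \<Rightarrow> (nat \<Rightarrow> 'a sqmat) \<Rightarrow> bool" where
  "primitive_idempotents X d R E \<longleftrightarrow>
     (\<forall>i\<le>d. E i \<in> bose_mesner d R \<and> E i \<noteq> (\<lambda>x y. 0)) \<and>
     (\<forall>i\<le>d. \<forall>j\<le>d. mat_mult X (E i) (E j) = (if i = j then E i else (\<lambda>x y. 0))) \<and>
     lin_comb {..d} (\<lambda>_. 1) E = rel_mat (Id_on X)"

text \<open>
  \<open>P i j\<close> is the eigenvalue of the \<open>j\<close>-th relation on the \<open>i\<close>-th eigenspace, the eigenspaces being
  enumerated in some order.
\<close>

definition first_eigenmatrix ::
    "'a set \<Rightarrow> nat \<Rightarrow> (nat \<Rightarrow> 'a rel) \<Rightarrow> (nat \<Rightarrow> nat \<Rightarrow> real) \<Rightarrow> bool" where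
  "first_eigenmatrix X d R P \<longleftrightarrow>
     (\<exists>E. primitive_idempotents X d R E \<and>
          (\<forall>j\<le>d. rel_mat (R j) = lin_comb {..d} (\<lambda>i. P i j) E))"


section \<open>Regular points\<close>

definition regular_point_matrix :: "real \<Rightarrow> nat \<Rightarrow> nat \<Rightarrow> real" where
  "regular_point_matrix q i j =
     [[1, q^2 - 1, (q - 1) * (q^2 - 1), q - 1],
      [1, q - 1,   1 - q,               -1],
      [1, -1,      1 - q,               q - 1],
      [1, -q - 1,  q + 1,               -1]] ! i ! j"

definition regular_point :: "nat \<Rightarrow> 'a pair_pre_digraph \<Rightarrow> 'a \<Rightarrow> bool" where
  "regular_point q G v \<longleftrightarrow> v \<in> pverts G \<and>
     (let D = second_subconstituent G v; X = pverts D in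
        \<exists>R. R 1 = parcs D \<and> generates_scheme (rel_mat (parcs D)) X 3 R \<and>
            first_eigenmatrix X 3 R (regular_point_matrix (real q)))"


section \<open>Affine planes\<close>

record ('p, 'l) incidence_structure =
  points :: "'p set"
  lines :: "'l set"
  inc :: "'p \<Rightarrow> 'l \<Rightarrow> bool"

definition parallel :: "('p, 'l) incidence_structure \<Rightarrow> 'l \<Rightarrow> 'l \<Rightarrow> bool" where
  "parallel I l m \<longleftrightarrow> l = m \<or> \<not> (\<exists>p\<in>points I. inc I p l \<and> inc I p m)"

definition affine_plane :: "('p, 'l) incidence_structure \<Rightarrow> bool" where
  "affine_plane I \<longleftrightarrow>
     (\<forall>p\<in>points I. \<forall>p'\<in>points I. p \<noteq> p' \<longrightarrow> (\<exists>!l. l \<in> lines I \<and> inc I p l \<and> inc I p' l)) \<and>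
     (\<forall>l\<in>lines I. \<forall>p\<in>points I. \<not> inc I p l \<longrightarrow>
        (\<exists>!m. m \<in> lines I \<and> inc I p m \<and> parallel I l m)) \<and>
     (\<exists>p\<in>points I. \<exists>p'\<in>points I. \<exists>p''\<in>points I. distinct [p, p', p''] \<and>
        \<not> (\<exists>l\<in>lines I. inc I p l \<and> inc I p' l \<and> inc I p'' l))"

definition affine_plane_of_order :: "('p, 'l) incidence_structure \<Rightarrow> nat \<Rightarrow> bool" where
  "affine_plane_of_order I q \<longleftrightarrow>
     affine_plane I \<and> (\<forall>l\<in>lines I. card {p \<in> points I. inc I p l} = q)"


section \<open>The graph built from a cover, an affine plane and a bijection\<close>

datatype ('l, 'h) cover_vertex = Apex | Line 'l | Vert 'h

definition cover_plane_graph ::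
    "'h pair_pre_digraph \<Rightarrow> ('p, 'l) incidence_structure \<Rightarrow> ('h set \<Rightarrow> 'p) \<Rightarrow>
     ('l, 'h) cover_vertex pair_pre_digraph" where
  "cover_plane_graph H I \<phi> =
     \<lparr>pverts = {Apex} \<union> Line ` lines I \<union> Vert ` pverts H,
      parcs =
        (let A = {(Apex, Line l) |l. l \<in> lines I};
             B = {(Line l, Line m) |l m. l \<in> lines I \<and> m \<in> lines I \<and> l \<noteq> m \<and> parallel I l m};
             C = {(Line l, Vert x) |l x. l \<in> lines I \<and> (\<exists>W\<in>fibres H. x \<in> W \<and> inc I (\<phi> W) l)};
             D = {(Vert x, Vert y) |x y. (x, y) \<in> parcs H}
         in A \<union> A\<inverse> \<union> B \<union> C \<union> C\<inverse> \<union> D)\<rparr>"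

end

theory Submission
  imports Defs
begin

text \<open>
  Both directions rest on a count of common neighbours. Let \<open>\<Gamma>\<close> be strongly regular with the given
  parameters, and suppose that its second subconstituent at \<open>v\<close> is an antipodal \<open>q\<close>-cover of a complete
  graph on \<open>q\<^sup>2\<close> vertices. Two vertices of the cover have \<open>q - 1\<close> or \<open>q + 1\<close> common neighbours in \<open>\<Gamma>\<close>,
  and \<open>q - 2\<close>, \<open>q\<close> or \<open>0\<close> in the cover, according to their distance \<open>1\<close>, \<open>2\<close> or \<open>3\<close> there. The
  difference is the number of common neighbours among the neighbours of \<open>v\<close>: it is \<open>1\<close> for vertices
  of different fibres and \<open>q + 1\<close> for those of one fibre, and \<open>q + 1\<close> is all that a vertex has there.
  So a neighbour of \<open>v\<close> is adjacent to all or to none of the vertices of a fibre, and with the fibres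
  as points and the neighbours of \<open>v\<close> as lines one gets a \<open>2-(q\<^sup>2, q, 1)\<close> design, that is, an affine
  plane of order \<open>q\<close>. Adjacent lines have only \<open>q - 1\<close> common neighbours, too few to contain a fibre,
  hence are parallel; as both relations leave \<open>q - 1\<close> choices they coincide, and \<open>\<Gamma>\<close> is the graph built
  from the cover and the plane (\<open>recover\<close>). Read backwards, the same counts show that this graph is
  strongly regular (\<open>strongly_regular_G\<close>).

  The covers enter in two guises, through an intersection array and through a first eigenmatrix. The
  locale \<open>antipodal_cover\<close> lists the counts that both guises share. The intersection array yields them
  by counting edges between distance classes (\<open>distance_regular_imp_antipodal_cover\<close>). The eigenmatrix
  yields them because products of relation matrices multiply eigenvalues
  (\<open>scheme_imp_antipodal_cover\<close>). Conversely, in a cover three products with the adjacency matrix \<open>A\<close>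
  determine the algebra generated by \<open>A\<close>. It is spanned by the four relations, so these form an
  association scheme, and its idempotents can be written down
  (\<open>generates_scheme_R\<close>, \<open>first_eigenmatrix_R\<close>).
\<close>

section \<open>Distances and isomorphisms\<close>

text \<open>
  Distances are infima over walks. With unit costs they are least exponents of relation powers, where
  small cases can be computed.
\<close>

lemma (in pair_wf_digraph) awalk_length_iff_relpow:
  "(\<exists>p. awalk u p w \<and> length p = n) \<longleftrightarrow> u \<in> pverts G \<and> (u, w) \<in> parcs G ^^ n"
proof (induction n arbitrary: u)
  case 0
  show ?case by (auto simp: awalk_Nil_iff)
next
  case (Suc n)
  have "(\<exists>p. awalk u p w \<and> length p = Suc n) \<longleftrightarrow>
      (\<exists>e p. awalk u (e # p) w \<and> length p = n)"
    by (metis Suc_length_conv)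
  also have "\<dots> \<longleftrightarrow> (\<exists>z. (u, z) \<in> parcs G \<and> (\<exists>p. awalk z p w \<and> length p = n))"
    by (auto simp: awalk_Cons_iff)
  also have "\<dots> \<longleftrightarrow> (\<exists>z. (u, z) \<in> parcs G \<and> (z, w) \<in> parcs G ^^ n)"
    unfolding Suc.IH using wellformed' by blast
  also have "\<dots> \<longleftrightarrow> (u, w) \<in> parcs G ^^ Suc n"
    by (meson relpow_Suc_D2 relpow_Suc_I2)
  also have "\<dots> \<longleftrightarrow> u \<in> pverts G \<and> (u, w) \<in> parcs G ^^ Suc n"
    using wellformed' by (meson relpow_Suc_D2)
  finally show ?case .
qed

lemma gdist_le:
  assumes "pair_wf_digraph G" "u \<in> pverts G" "(u, w) \<in> parcs G ^^ n"
  shows "gdist G u w \<le> ereal (real n)"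
proof -
  interpret pair_wf_digraph G by fact
  obtain p where p: "awalk u p w" "length p = n"
    using assms awalk_length_iff_relpow by blast
  have "awalk_cost (\<lambda>_. 1) p = real (length p)"
    by (simp add: awalk_cost_def sum_list_triv)
  with p min_cost_le_walk_cost[of u p w "\<lambda>_. 1"] show ?thesis
    unfolding gdist_def by simp
qed

lemma gdist_eqI:
  assumes "pair_wf_digraph G" "u \<in> pverts G" "(u, w) \<in> parcs G ^^ n"
    and "\<And>m. m < n \<Longrightarrow> (u, w) \<notin> parcs G ^^ m"
  shows "gdist G u w = ereal (real n)"
proof -
  interpret pair_wf_digraph G by fact
  have "ereal (real n) \<le> gdist G u w"
    unfolding gdist_def \<mu>_def
  proof (rule INF_greatest)
    fix p assume "p \<in> {p. awalk u p w}"
    then have "(u, w) \<in> parcs G ^^ length p"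
      using awalk_length_iff_relpow by blast
    then have "n \<le> length p" using assms(4) not_less by blast
    then show "ereal (real n) \<le> ereal (awalk_cost (\<lambda>_. 1) p)"
      by (simp add: awalk_cost_def sum_list_triv)
  qed
  with gdist_le[OF assms(1-3)] show ?thesis by simp
qed

lemma gdist_infinity:
  assumes "pair_wf_digraph G" "\<And>n. (u, w) \<notin> parcs G ^^ n"
  shows "gdist G u w = \<infinity>"
proof -
  interpret pair_wf_digraph G by fact
  have "{p. awalk u p w} = {}"
    using assms(2) awalk_length_iff_relpow by blast
  then show ?thesis by (simp add: gdist_def \<mu>_def top_ereal_def)
qed

lemma gdist_eq_iff:
  assumes G: "pair_wf_digraph G" "u \<in> pverts G"
  shows "gdist G u w = ereal (real n) \<longleftrightarrow>
    (u, w) \<in> parcs G ^^ n \<and> (\<forall>m<n. (u, w) \<notin> parcs G ^^ m)"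
proof (cases "\<exists>k. (u, w) \<in> parcs G ^^ k")
  case True
  define k where "k = (LEAST k. (u, w) \<in> parcs G ^^ k)"
  have k: "(u, w) \<in> parcs G ^^ k" "\<And>m. m < k \<Longrightarrow> (u, w) \<notin> parcs G ^^ m"
    using True unfolding k_def by (auto intro: LeastI dest: not_less_Least)
  have "gdist G u w = ereal (real k)" using gdist_eqI[OF G k] .
  with k show ?thesis by (auto simp: linorder_neq_iff) (metis linorder_neqE_nat)
next
  case False
  then show ?thesis using gdist_infinity[OF G(1)] by simp
qed

lemma gdist_eq_of_nat_or_infinity:
  assumes "pair_wf_digraph G" "u \<in> pverts G"
  shows "(\<exists>n::nat. gdist G u w = ereal (real n)) \<or> gdist G u w = \<infinity>"
proof (cases "\<exists>k. (u, w) \<in> parcs G ^^ k")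
  case True
  then have "\<exists>k. (u, w) \<in> parcs G ^^ k \<and> (\<forall>m<k. (u, w) \<notin> parcs G ^^ m)"
    by (rule exists_least_iff[THEN iffD1])
  then show ?thesis using gdist_eqI[OF assms] by metis
qed (simp add: gdist_infinity[OF assms(1)])

context pair_graph
begin

lemma arc_sym: "(x, y) \<in> parcs G \<Longrightarrow> (y, x) \<in> parcs G"
  using pair_sym_arcs by (auto simp: symmetric_def sym_def)

lemma no_loop: "(x, x) \<notin> parcs G"
  using pair_no_loops by force

lemma finite_neighbours: "finite (parcs G `` S)"
  using pair_finite_arcs by (rule finite_Image)

lemma gdist_eq_0: "x \<in> pverts G \<Longrightarrow> gdist G x y = 0 \<longleftrightarrow> x = y"
  using gdist_eq_iff[OF pair_wf_digraph, of x y 0] by (simp add: zero_ereal_def)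

lemma gdist_eq_1: "x \<in> pverts G \<Longrightarrow> gdist G x y = 1 \<longleftrightarrow> (x, y) \<in> parcs G"
  using gdist_eq_iff[OF pair_wf_digraph, of x y 1] no_loop by (auto simp: one_ereal_def)

lemma gdist_eq_2:
  assumes "x \<in> pverts G"
  shows "gdist G x y = 2 \<longleftrightarrow>
     x \<noteq> y \<and> (x, y) \<notin> parcs G \<and> parcs G `` {x} \<inter> parcs G `` {y} \<noteq> {}"
proof -
  have two: "(x, y) \<in> parcs G ^^ 2 \<longleftrightarrow> parcs G `` {x} \<inter> parcs G `` {y} \<noteq> {}"
    by (auto simp: numeral_2_eq_2 dest: arc_sym)
  have "gdist G x y = 2 \<longleftrightarrow> (x, y) \<in> parcs G ^^ 2 \<and> (\<forall>m<2. (x, y) \<notin> parcs G ^^ m)"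
    using gdist_eq_iff[OF pair_wf_digraph assms, of y 2] by simp
  also have "(\<forall>m<2. (x, y) \<notin> parcs G ^^ m) \<longleftrightarrow> x \<noteq> y \<and> (x, y) \<notin> parcs G"
    by (auto simp: numeral_2_eq_2 less_Suc_eq)
  finally show ?thesis using two by blast
qed

text \<open>A graph of diameter at most three needs no walks longer than two to tell its distances apart.\<close>

lemma gdist_eq_3:
  assumes x: "x \<in> pverts G" and le3: "gdist G x y \<le> 3"
  shows "gdist G x y = 3 \<longleftrightarrow>
     x \<noteq> y \<and> (x, y) \<notin> parcs G \<and> parcs G `` {x} \<inter> parcs G `` {y} = {}"
proof -
  obtain n :: nat where n: "gdist G x y = ereal (real n)"
    using gdist_eq_of_nat_or_infinity[OF pair_wf_digraph x, of y] le3 by auto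
  then have "n \<le> 3" using le3 by simp
  then consider "n = 0" | "n = 1" | "n = 2" | "n = 3" by linarith
  then have "gdist G x y = 3 \<longleftrightarrow> gdist G x y \<noteq> 0 \<and> gdist G x y \<noteq> 1 \<and> gdist G x y \<noteq> 2"
    unfolding n by cases (simp_all add: zero_ereal_def one_ereal_def)
  then show ?thesis
    unfolding gdist_eq_0[OF x] gdist_eq_1[OF x] gdist_eq_2[OF x] by blast
qed

end

text \<open>
  Arcs are pairs of vertices here, so an isomorphism is its action on the vertices.
\<close>

lemma digraph_iso_with_proj_iff:
  "digraph_iso (with_proj G) (with_proj H) \<longleftrightarrow>
     pair_wf_digraph G \<and>
     (\<exists>f. inj_on f (pverts G) \<and> pverts H = f ` pverts G \<and> parcs H = map_prod f f ` parcs G)"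
  (is "?L \<longleftrightarrow> ?wf \<and> ?R")
proof (intro iffI conjI)
  assume ?L
  then obtain h where h: "pre_digraph.digraph_isomorphism (with_proj G) h"
    and H: "with_proj H = app_iso h (with_proj G)"
    unfolding digraph_iso_def by blast
  show "pair_wf_digraph G"
    using h by (simp add: pre_digraph.digraph_isomorphism_def wf_digraph_wp_iff)
  have ends: "iso_tail h = fst" "iso_head h = snd"
    using arg_cong[OF H, of tail] arg_cong[OF H, of head] by simp_all
  have arcs: "iso_arcs h e = map_prod (iso_verts h) (iso_verts h) e" if "e \<in> parcs G" for e
    using h that unfolding pre_digraph.digraph_isomorphism_def ends
    by (auto simp: prod_eq_iff)
  have "parcs H = iso_arcs h ` parcs G" using arg_cong[OF H, of arcs] by simp
  also have "\<dots> = map_prod (iso_verts h) (iso_verts h) ` parcs G"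
    using arcs by (rule image_cong[OF refl])
  finally have "parcs H = map_prod (iso_verts h) (iso_verts h) ` parcs G" .
  moreover have "pverts H = iso_verts h ` pverts G" using arg_cong[OF H, of verts] by simp
  moreover have "inj_on (iso_verts h) (pverts G)"
    using h by (simp add: pre_digraph.digraph_isomorphism_def)
  ultimately show ?R by blast
next
  assume "?wf \<and> ?R"
  then obtain f where wf: "pair_wf_digraph G" and f: "inj_on f (pverts G)"
    and H: "pverts H = f ` pverts G" "parcs H = map_prod f f ` parcs G" by blast
  interpret pair_wf_digraph G by fact
  define h :: "('a, 'a \<times> 'a, 'b, 'b \<times> 'b) digraph_isomorphism" where
    "h = \<lparr>iso_verts = f, iso_arcs = map_prod f f, iso_head = snd, iso_tail = fst\<rparr>"
  have "inj_on (map_prod f f) (parcs G)"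
    using f wellformed' by (auto simp: inj_on_def)
  then have "pre_digraph.digraph_isomorphism (with_proj G) h"
    using f wf by (auto simp: pre_digraph.digraph_isomorphism_def h_def wf_digraph_wp_iff)
  moreover have "with_proj H = app_iso h (with_proj G)"
    by (simp add: with_proj_def app_iso_def h_def H)
  ultimately show ?L unfolding digraph_iso_def by blast
qed

lemma map_prod_in_image_iff:
  assumes "inj_on f X" "R \<subseteq> X \<times> X" "x \<in> X" "y \<in> X"
  shows "(f x, f y) \<in> map_prod f f ` R \<longleftrightarrow> (x, y) \<in> R"
proof
  assume "(f x, f y) \<in> map_prod f f ` R"
  then obtain a b where ab: "(a, b) \<in> R" "f a = f x" "f b = f y" by auto
  then have "a = x" "b = y" using assms(2-4) by (auto intro!: inj_onD[OF assms(1)])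
  with ab show "(x, y) \<in> R" by simp
qed force

lemma map_prod_image_Image:
  assumes "inj_on f X" "R \<subseteq> X \<times> X" "x \<in> X"
  shows "(map_prod f f ` R) `` {f x} = f ` (R `` {x})"
proof (intro subset_antisym subsetI)
  fix z assume "z \<in> (map_prod f f ` R) `` {f x}"
  then obtain a b where ab: "(a, b) \<in> R" "f a = f x" "z = f b" by auto
  then have "a = x" using assms(2,3) by (auto intro!: inj_onD[OF assms(1)])
  with ab show "z \<in> f ` (R `` {x})" by blast
qed force

lemma card_Image_Int_map_prod:
  assumes f: "inj_on f X" and R: "R \<subseteq> X \<times> X" and xy: "x \<in> X" "y \<in> X"
  shows "card ((map_prod f f ` R) `` {f x} \<inter> (map_prod f f ` R) `` {f y}) =
    card (R `` {x} \<inter> R `` {y})"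
proof -
  have "(map_prod f f ` R) `` {f x} \<inter> (map_prod f f ` R) `` {f y} = f ` (R `` {x} \<inter> R `` {y})"
    unfolding map_prod_image_Image[OF f R xy(1)] map_prod_image_Image[OF f R xy(2)]
    using R by (intro inj_on_image_Int[OF f, symmetric]) auto
  moreover have "inj_on f (R `` {x} \<inter> R `` {y})" using R by (intro inj_on_subset[OF f]) auto
  ultimately show ?thesis by (simp add: card_image)
qed

lemma strongly_regular_reflect_iso:
  assumes srg: "strongly_regular H n k l m" and G: "pair_graph G"
    and f: "inj_on f (pverts G)" and V: "pverts H = f ` pverts G"
    and E: "parcs H = map_prod f f ` parcs G"
  shows "strongly_regular G n k l m"
proof -
  interpret pair_graph G by fact
  have R: "parcs G \<subseteq> pverts G \<times> pverts G" by (auto dest: wellformed')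
  have deg: "card (parcs H `` {f u}) = card (parcs G `` {u})" if "u \<in> pverts G" for u
    using card_Image_Int_map_prod[OF f R that that] by (simp add: E)
  have V': "card (pverts H) = card (pverts G)" by (simp add: V card_image[OF f])
  have "card (parcs G `` {u}) = k" if "u \<in> pverts G" for u
    using srg that deg[OF that] unfolding strongly_regular_def V by auto
  moreover have "card (parcs G `` {u} \<inter> parcs G `` {w}) = l"
    if "u \<in> pverts G" "w \<in> pverts G" "(u, w) \<in> parcs G" for u w
    using srg that card_Image_Int_map_prod[OF f R that(1,2)] map_prod_in_image_iff[OF f R that(1,2)]
    unfolding strongly_regular_def V E by auto
  moreover have "card (parcs G `` {u} \<inter> parcs G `` {w}) = m"
    if "u \<in> pverts G" "w \<in> pverts G" "u \<noteq> w" "(u, w) \<notin> parcs G" for u w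
  proof -
    have "f u \<noteq> f w" using that inj_onD[OF f, of u w] by blast
    moreover have "(f u, f w) \<notin> parcs H"
      using that map_prod_in_image_iff[OF f R that(1,2)] by (simp add: E)
    ultimately have "card (parcs H `` {f u} \<inter> parcs H `` {f w}) = m"
      using srg that(1,2) unfolding strongly_regular_def V by blast
    then show ?thesis using card_Image_Int_map_prod[OF f R that(1,2)] by (simp add: E)
  qed
  ultimately show ?thesis
    using srg G V' unfolding strongly_regular_def by simp
qed

section \<open>Antipodal covers\<close>

text \<open>
  \<open>A\<close> is adjacency and the classes of \<open>S\<close> are the fibres. The assumptions form the common ground
  between the intersection array and the first eigenmatrix: each of the two yields these counts,
  and each can be recovered from them. The assumption \<open>matching\<close> says that the edges between
  two fibres form a perfect matching.
\<close>

locale antipodal_cover =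
  fixes q :: nat and X :: "'a set" and A S :: "'a rel"
  assumes q_ge_2: "2 \<le> q" and finite_X: "finite X" and X_nonempty: "X \<noteq> {}"
    and A_subset: "A \<subseteq> X \<times> X" and sym_A: "sym A"
    and equiv_S: "equiv X S" and A_S_disjoint: "A \<inter> S = {}"
    and degree: "x \<in> X \<Longrightarrow> card (A `` {x}) = q^2 - 1"
    and adjacent_common: "(x, y) \<in> A \<Longrightarrow> card (A `` {x} \<inter> A `` {y}) = q - 2"
    and distance_2_common:
      "x \<in> X \<Longrightarrow> y \<in> X \<Longrightarrow> (x, y) \<notin> A \<Longrightarrow> (x, y) \<notin> S \<Longrightarrow> card (A `` {x} \<inter> A `` {y}) = q"
    and fibre_common: "(x, y) \<in> S \<Longrightarrow> x \<noteq> y \<Longrightarrow> A `` {x} \<inter> A `` {y} = {}"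
    and matching: "x \<in> X \<Longrightarrow> y \<in> X \<Longrightarrow> (x, y) \<notin> S \<Longrightarrow> \<exists>!z. (x, z) \<in> A \<and> (z, y) \<in> S"
    and card_fibre: "x \<in> X \<Longrightarrow> card (S `` {x}) = q"
begin

lemma A_symD: "(x, y) \<in> A \<Longrightarrow> (y, x) \<in> A"
  using sym_A by (auto dest: symD)

lemma S_symD: "(x, y) \<in> S \<Longrightarrow> (y, x) \<in> S"
  using equiv_S by (auto simp: equiv_def dest: symD)

lemma S_trans: "(x, y) \<in> S \<Longrightarrow> (y, z) \<in> S \<Longrightarrow> (x, z) \<in> S"
  using equiv_S by (auto simp: equiv_def dest: transD)

lemma S_refl: "x \<in> X \<Longrightarrow> (x, x) \<in> S"
  using equiv_S by (auto simp: equiv_def refl_on_def)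

lemma S_subset: "S \<subseteq> X \<times> X"
  using equiv_S by (auto simp: equiv_def refl_on_def)

lemma A_irrefl: "(x, x) \<notin> A"
  using A_S_disjoint S_refl A_subset by blast

lemma q_squares: "q < q^2" "1 < q^2"
  using q_ge_2 by (simp_all add: power2_eq_square) (use mult_le_mono[of 2 q 2 q] in linarith)

lemma finite_A_Image: "finite (A `` Y)"
  using finite_subset[OF A_subset] finite_X by (simp add: finite_Image)

text \<open>
  The map \<open>p\<close> labels the fibres. Since the neighbours of a vertex meet each of the other fibres
  exactly once, the valency \<open>q\<^sup>2 - 1\<close> is one less than the number of fibres.
\<close>

lemma card_points:
  assumes p: "\<And>x y. x \<in> X \<Longrightarrow> y \<in> X \<Longrightarrow> p x = p y \<longleftrightarrow> (x, y) \<in> S"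
  shows "x \<in> X \<Longrightarrow> inj_on p (A `` {x})"
    and "x \<in> X \<Longrightarrow> p ` A `` {x} = p ` X - {p x}"
    and "card (p ` X) = q^2"
proof -
  show inj: "inj_on p (A `` {x})" if x: "x \<in> X" for x
  proof (rule inj_onI)
    fix y z assume yz: "y \<in> A `` {x}" "z \<in> A `` {x}" "p y = p z"
    then have "(y, z) \<in> S" using p A_subset by auto
    then show "y = z" using yz fibre_common[of y z] A_symD by blast
  qed
  show img: "p ` A `` {x} = p ` X - {p x}" if x: "x \<in> X" for x
  proof (intro subset_antisym subsetI)
    fix t assume "t \<in> p ` A `` {x}"
    then obtain y where y: "(x, y) \<in> A" "t = p y" by auto
    then show "t \<in> p ` X - {p x}"
      using A_S_disjoint A_subset p[of y x] x S_symD by auto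
  next
    fix t assume "t \<in> p ` X - {p x}"
    then obtain y where y: "y \<in> X" "t = p y" "p y \<noteq> p x" by auto
    then have "(x, y) \<notin> S" using p[OF x y(1)] by simp
    then obtain z where "(x, z) \<in> A" "(z, y) \<in> S" using matching[OF x y(1)] by blast
    then have "p z = t" using p[of z y] y A_subset by auto
    then show "t \<in> p ` A `` {x}" using \<open>(x, z) \<in> A\<close> by blast
  qed
  obtain x where x: "x \<in> X" using X_nonempty by blast
  have "card (p ` X - {p x}) = q^2 - 1"
    using card_image[OF inj[OF x]] degree[OF x] by (simp add: img[OF x])
  then show "card (p ` X) = q^2"
    using x finite_X q_squares by (simp add: card_Diff_singleton_if)
qed

lemma card_fibre_of_point:
  assumes p: "\<And>x y. x \<in> X \<Longrightarrow> y \<in> X \<Longrightarrow> p x = p y \<longleftrightarrow> (x, y) \<in> S" and t: "t \<in> p ` X"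
  shows "card {x \<in> X. p x = t} = q"
proof -
  obtain y where y: "y \<in> X" "t = p y" using t by blast
  have "{x \<in> X. p x = t} = S `` {y}" using p y S_subset S_symD by fastforce
  then show ?thesis using card_fibre[OF y(1)] by simp
qed

lemma card_over_points:
  assumes p: "\<And>x y. x \<in> X \<Longrightarrow> y \<in> X \<Longrightarrow> p x = p y \<longleftrightarrow> (x, y) \<in> S" and T: "T \<subseteq> p ` X"
  shows "card {x \<in> X. p x \<in> T} = q * card T"
proof -
  have fin: "finite T" using T finite_X finite_surj by blast
  have "{x \<in> X. p x \<in> T} = (\<Union>t\<in>T. {x \<in> X. p x = t})" by auto
  also have "card \<dots> = (\<Sum>t\<in>T. card {x \<in> X. p x = t})"
    by (rule card_UN_disjoint) (use fin finite_X in auto)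
  also have "\<dots> = (\<Sum>t\<in>T. q)"
    using card_fibre_of_point[OF p] T by (intro sum.cong) auto
  finally show ?thesis by simp
qed

lemma card_X: "card X = q^3"
proof -
  let ?p = "\<lambda>x. S `` {x}"
  have p: "?p x = ?p y \<longleftrightarrow> (x, y) \<in> S" if "x \<in> X" "y \<in> X" for x y
    using eq_equiv_class_iff[OF equiv_S that] by simp
  have "{x \<in> X. ?p x \<in> ?p ` X} = X" by blast
  then show ?thesis
    using card_over_points[of ?p "?p ` X", OF p subset_refl] card_points(3)[of ?p, OF p]
    by (simp add: power_numeral_reduce)
qed

lemma card_neighbours_over_points:
  assumes p: "\<And>x y. x \<in> X \<Longrightarrow> y \<in> X \<Longrightarrow> p x = p y \<longleftrightarrow> (x, y) \<in> S" and T: "T \<subseteq> p ` X"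
    and x: "x \<in> X"
  shows "card {y \<in> A `` {x}. p y \<in> T} = card (T - {p x})"
proof -
  have "p ` {y \<in> A `` {x}. p y \<in> T} = p ` A `` {x} \<inter> T" by auto
  also have "\<dots> = T - {p x}" using T by (auto simp: card_points(2)[OF p x])
  finally have "p ` {y \<in> A `` {x}. p y \<in> T} = T - {p x}" .
  moreover have "inj_on p {y \<in> A `` {x}. p y \<in> T}"
    by (rule inj_on_subset[OF card_points(1)[OF p x]]) auto
  ultimately show ?thesis by (metis card_image)
qed

text \<open>
  Adjacency determines the fibres; this identifies the fibre relation with the relation of being equal
  or at distance three.
\<close>

lemma in_S_iff:
  assumes "x \<in> X" "y \<in> X"
  shows "(x, y) \<in> S \<longleftrightarrow> x = y \<or> (x, y) \<notin> A \<and> A `` {x} \<inter> A `` {y} = {}"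
proof -
  have "A `` {x} \<inter> A `` {y} \<noteq> {}" if "(x, y) \<notin> A" "(x, y) \<notin> S"
    using distance_2_common[OF assms that] q_ge_2 by auto
  then show ?thesis using fibre_common[of x y] S_refl[of x] A_S_disjoint assms by blast
qed

text \<open>
  A neighbour \<open>w\<close> of \<open>x\<close> lies in a fibre other than that of \<open>y\<close> and is not adjacent to \<open>y\<close>, so it has
  \<open>q\<close> common neighbours with \<open>y\<close>.
\<close>

lemma relpow_3:
  assumes S: "(x, y) \<in> S" and "x \<noteq> y"
  shows "(x, y) \<in> A ^^ 3"
proof -
  have xy: "x \<in> X" "y \<in> X" using S S_subset by auto
  have "A `` {x} \<noteq> {}" using degree[OF xy(1)] q_squares by auto
  then obtain w where w: "(x, w) \<in> A" by blast
  then have "w \<in> X" "(w, y) \<notin> A" "(w, y) \<notin> S"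
    using A_subset fibre_common[OF assms] A_symD A_S_disjoint S_trans[OF S S_symD, of w] by blast+
  then have "A `` {w} \<inter> A `` {y} \<noteq> {}" using in_S_iff[of w y] xy by blast
  then obtain z where "(w, z) \<in> A" "(z, y) \<in> A" using A_symD by blast
  with w show ?thesis by (auto simp: numeral_3_eq_3)
qed

end

text \<open>
  The vertex type of a cover can be exchanged freely. This moves a cover out of a strongly regular
  graph into another type, and back along an isomorphism.
\<close>

lemma antipodal_cover_image:
  assumes "antipodal_cover q X A S" and f: "inj_on f X"
  shows "antipodal_cover q (f ` X) (map_prod f f ` A) (map_prod f f ` S)"
proof -
  interpret antipodal_cover q X A S by fact
  note A = A_subset and S = S_subset
  have fA: "(f x, f y) \<in> map_prod f f ` A \<longleftrightarrow> (x, y) \<in> A" if "x \<in> X" "y \<in> X" for x y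
    using map_prod_in_image_iff[OF f A that] .
  have fS: "(f x, f y) \<in> map_prod f f ` S \<longleftrightarrow> (x, y) \<in> S" if "x \<in> X" "y \<in> X" for x y
    using map_prod_in_image_iff[OF f S that] .
  have card: "card ((map_prod f f ` A) `` {f x} \<inter> (map_prod f f ` A) `` {f y}) =
      card (A `` {x} \<inter> A `` {y})" if "x \<in> X" "y \<in> X" for x y
    using card_Image_Int_map_prod[OF f A that] .
  show ?thesis
  proof
    show "2 \<le> q" by (rule q_ge_2)
    show "finite (f ` X)" "f ` X \<noteq> {}" using finite_X X_nonempty by simp_all
    show "map_prod f f ` A \<subseteq> f ` X \<times> f ` X" using A by auto
    show "sym (map_prod f f ` A)" using sym_A by (force simp: sym_def)
    show "map_prod f f ` A \<inter> map_prod f f ` S = {}"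
    proof -
      have "map_prod f f ` A \<inter> map_prod f f ` S = map_prod f f ` (A \<inter> S)"
        by (rule inj_on_image_Int[symmetric, OF map_prod_inj_on[OF f f] A S])
      then show ?thesis using A_S_disjoint by simp
    qed
    show "equiv (f ` X) (map_prod f f ` S)"
    proof (rule equivI)
      show "map_prod f f ` S \<subseteq> f ` X \<times> f ` X" using S by auto
      show "refl_on (f ` X) (map_prod f f ` S)" using S S_refl by (auto simp: refl_on_def)
      show "sym (map_prod f f ` S)" using S_symD by (force simp: sym_def)
      show "trans (map_prod f f ` S)"
      proof (rule transI)
        fix x y z assume "(x, y) \<in> map_prod f f ` S" "(y, z) \<in> map_prod f f ` S"
        then obtain a b b' c where *: "(a, b) \<in> S" "(b', c) \<in> S" "f b = f b'" "x = f a" "z = f c"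
          by auto
        then have "b = b'" using S by (auto intro!: inj_onD[OF f])
        with * S_trans show "(x, z) \<in> map_prod f f ` S" by blast
      qed
    qed
    fix x y
    show "x \<in> f ` X \<Longrightarrow> card ((map_prod f f ` A) `` {x}) = q\<^sup>2 - 1"
      using card[of a a for a] degree by auto
    show "x \<in> f ` X \<Longrightarrow> card ((map_prod f f ` S) `` {x}) = q"
      using card_Image_Int_map_prod[OF f S, of a a for a] card_fibre by auto
    show "(x, y) \<in> map_prod f f ` A \<Longrightarrow>
        card ((map_prod f f ` A) `` {x} \<inter> (map_prod f f ` A) `` {y}) = q - 2"
      using card adjacent_common A by auto
    show "x \<in> f ` X \<Longrightarrow> y \<in> f ` X \<Longrightarrow> (x, y) \<notin> map_prod f f ` A \<Longrightarrow> (x, y) \<notin> map_prod f f ` S \<Longrightarrow>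
        card ((map_prod f f ` A) `` {x} \<inter> (map_prod f f ` A) `` {y}) = q"
      using card distance_2_common fA fS by (auto simp del: map_prod_simp)
    show "(map_prod f f ` A) `` {x} \<inter> (map_prod f f ` A) `` {y} = {}"
      if xy: "(x, y) \<in> map_prod f f ` S" "x \<noteq> y"
    proof -
      obtain a b where ab: "(a, b) \<in> S" "x = f a" "y = f b" using xy(1) by auto
      then have "a \<in> X" "b \<in> X" using S by auto
      then show ?thesis
        using ab xy(2) fibre_common[of a b] inj_on_image_Int[OF f, of "A `` {a}" "A `` {b}"] A
        by (auto simp: map_prod_image_Image[OF f A])
    qed
    show "\<exists>!z. (x, z) \<in> map_prod f f ` A \<and> (z, y) \<in> map_prod f f ` S"
      if xy: "x \<in> f ` X" "y \<in> f ` X" "(x, y) \<notin> map_prod f f ` S"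
    proof -
      obtain a b where ab: "a \<in> X" "x = f a" "b \<in> X" "y = f b" using xy by auto
      then have "(a, b) \<notin> S" using xy(3) by auto
      with ab obtain c where c: "(a, c) \<in> A" "(c, b) \<in> S"
        and uniq: "\<And>d. (a, d) \<in> A \<Longrightarrow> (d, b) \<in> S \<Longrightarrow> d = c"
        using matching[of a b] by metis
      show ?thesis
      proof (rule ex1I[of _ "f c"])
        show "(x, f c) \<in> map_prod f f ` A \<and> (f c, y) \<in> map_prod f f ` S"
          using c ab by auto
        fix z assume z: "(x, z) \<in> map_prod f f ` A \<and> (z, y) \<in> map_prod f f ` S"
        then obtain d where "d \<in> X" "z = f d" using A by auto
        with z ab fA[of a d] fS[of d b] uniq show "z = f c" by auto
      qed
    qed
  qed
qed

lemma (in pair_graph) card_neighbours_split: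
  assumes "(u, w) \<in> parcs G"
  shows "card (parcs G `` {w}) = 1 + card (parcs G `` {u} \<inter> parcs G `` {w}) +
    card {z \<in> parcs G `` {w}. z \<noteq> u \<and> (u, z) \<notin> parcs G}" (is "_ = 1 + card ?C + card ?T")
proof -
  have fin: "finite ?C" "finite ?T"
    by (rule finite_subset[OF _ finite_neighbours[of "{w}"]]; blast)+
  have "parcs G `` {w} = insert u (?C \<union> ?T)"
    using assms arc_sym by auto
  moreover have "card (insert u (?C \<union> ?T)) = Suc (card (?C \<union> ?T))"
    using no_loop fin by (intro card_insert_disjoint) auto
  moreover have "card (?C \<union> ?T) = card ?C + card ?T"
    using fin by (intro card_Un_disjoint) auto
  ultimately show ?thesis by simp
qed

lemma (in pair_graph) symmetric_reachable_imp_connected: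
  assumes "pverts G \<noteq> {}"
    and "\<And>u w. u \<in> pverts G \<Longrightarrow> w \<in> pverts G \<Longrightarrow> \<exists>n. (u, w) \<in> parcs G ^^ n"
  shows "Digraph_Component.connected (with_proj G)"
  unfolding Digraph_Component.connected_def
proof (rule strongly_connectedI)
  show "verts (with_proj (mk_symmetric (with_proj G))) \<noteq> {}" using assms(1) by simp
  fix u w
  assume "u \<in> verts (with_proj (mk_symmetric (with_proj G)))"
    and "w \<in> verts (with_proj (mk_symmetric (with_proj G)))"
  then have "\<exists>p. awalk u p w" using assms(2)[of u w] awalk_length_iff_relpow[of u w] by auto
  then have "u \<rightarrow>\<^sup>*\<^bsub>with_proj G\<^esub> w" by (simp add: reachable_awalk)
  then show "u \<rightarrow>\<^sup>*\<^bsub>with_proj (mk_symmetric (with_proj G))\<^esub> w" by (rule reachable_mk_symmetricI)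
qed

text \<open>
  The fibres come from the end of the intersection array. By \<open>c\<^sub>3 = q\<^sup>2 - 1\<close> all neighbours of a vertex
  at distance three from \<open>x\<close> are at distance two, and by \<open>b\<^sub>2 = 1\<close> such a neighbour leads to only one
  vertex at distance three. So two vertices at distance three from \<open>x\<close> are neither adjacent nor
  joined by a common neighbour. The fibre size follows by counting the edges between consecutive
  distance classes.
\<close>

lemma distance_regular_imp_antipodal_cover:
  assumes q: "2 \<le> q" and dr: "distance_regular H [q^2 - 1, q^2 - q, 1] [1, q, q^2 - 1]"
  shows "antipodal_cover q (pverts H) (parcs H) (antipodal_rel H)"
proof -
  interpret pair_graph H using dr by (simp add: distance_regular_def)
  let ?V = "pverts H" and ?A = "parcs H" and ?S = "antipodal_rel H"
  have q_lt: "q < q^2" using q by (simp add: power2_eq_square)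
  have A_sub: "?A \<subseteq> ?V \<times> ?V" by (auto dest: wellformed')
  have le3: "gdist H u w \<le> 3" if "u \<in> ?V" "w \<in> ?V" for u w
  proof -
    have "gdist H u w \<le> diameter H"
      unfolding diameter_def using that by (intro SUP_upper2[of "(u, w)"]) auto
    also have "diameter H = 3" using dr by (simp add: distance_regular_def)
    finally show ?thesis .
  qed
  have counts:
    "gdist H u w = ereal (real i) \<Longrightarrow>
       card {z \<in> ?A `` {w}. gdist H u z = ereal (real (i + 1))} = [q^2 - 1, q^2 - q, 1] ! i"
    "gdist H u w = ereal (real (i + 1)) \<Longrightarrow>
       card {z \<in> ?A `` {w}. gdist H u z = ereal (real i)} = [1, q, q^2 - 1] ! i"
    if "u \<in> ?V" "w \<in> ?V" "i < 3" for u w i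
    using dr that unfolding distance_regular_def by auto
  \<comment> \<open>The forms in which the distances occur in the instances of \<open>counts\<close>.\<close>
  have e: "ereal (real 1) = 1" "ereal (real (0 + 1)) = 1" "ereal (real (1 + 1)) = 2"
    "ereal (real 2) = 2" "ereal (real (2 + 1)) = 3" "ereal (real 0) = 0" by simp_all
  have deg: "card (?A `` {u}) = q^2 - 1" if u: "u \<in> ?V" for u
  proof -
    have "{z \<in> ?A `` {u}. gdist H u z = 1} = ?A `` {u}" unfolding gdist_eq_1[OF u] by blast
    then show ?thesis using counts(1)[OF u u, of 0] unfolding e gdist_eq_0[OF u] by simp
  qed
  have b1: "card {z \<in> ?A `` {w}. gdist H u z = 2} = q^2 - q" if "(u, w) \<in> ?A" for u w
    using counts(1)[of u w 1] that A_sub unfolding e by (auto simp: gdist_eq_1)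
  have b2: "card {z \<in> ?A `` {w}. gdist H u z = 3} = 1"
    if "u \<in> ?V" "w \<in> ?V" "gdist H u w = 2" for u w
    using counts(1)[of u w 2] that unfolding e by simp
  have c2: "card (?A `` {u} \<inter> ?A `` {w}) = q"
    if u: "u \<in> ?V" and w: "w \<in> ?V" and uw: "gdist H u w = 2" for u w
  proof -
    have "{z \<in> ?A `` {w}. gdist H u z = 1} = ?A `` {u} \<inter> ?A `` {w}"
      using gdist_eq_1[OF u] by auto
    then show ?thesis using counts(2)[OF u w, of 1] uw unfolding e by simp
  qed
  have c3: "{z \<in> ?A `` {w}. gdist H u z = 2} = ?A `` {w}"
    if u: "u \<in> ?V" and w: "w \<in> ?V" and uw: "gdist H u w = 3" for u w
  proof (rule card_subset_eq)
    show "card {z \<in> ?A `` {w}. gdist H u z = 2} = card (?A `` {w})"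
      using counts(2)[OF u w, of 2] uw unfolding e deg[OF w] by simp
  qed (auto simp: finite_neighbours)
  have d3: "gdist H u w = 3 \<longleftrightarrow> u \<noteq> w \<and> (u, w) \<notin> ?A \<and> ?A `` {u} \<inter> ?A `` {w} = {}"
    if "u \<in> ?V" "w \<in> ?V" for u w
    using gdist_eq_3[OF that(1) le3[OF that]] .
  have S_iff: "(u, w) \<in> ?S \<longleftrightarrow> u = w \<or> (u, w) \<notin> ?A \<and> ?A `` {u} \<inter> ?A `` {w} = {}"
    if "u \<in> ?V" "w \<in> ?V" for u w
    using that d3[OF that] unfolding antipodal_rel_def by blast
  have S_sub: "?S \<subseteq> ?V \<times> ?V" by (auto simp: antipodal_rel_def)
  have S_sym: "sym ?S"
    by (rule symI) (use S_iff S_sub arc_sym in blast)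
  have S_trans: "(y, z) \<in> ?S" if xy: "(x, y) \<in> ?S" and xz: "(x, z) \<in> ?S" for x y z
  proof (cases "x = y \<or> x = z \<or> y = z")
    case True
    then show ?thesis using xy xz S_sym S_sub by (auto dest: symD simp: antipodal_rel_def)
  next
    case False
    have V: "x \<in> ?V" "y \<in> ?V" "z \<in> ?V" using xy xz S_sub by auto
    have 3: "gdist H x y = 3" "gdist H x z = 3" using False xy xz by (auto simp: antipodal_rel_def)
    \<comment> \<open>A vertex at distance two from \<open>x\<close> has a single neighbour at distance three from \<open>x\<close>.\<close>
    have "(y, w) \<notin> ?A \<or> (z, w) \<notin> ?A" for w
    proof (rule ccontr)
      assume "\<not> ?thesis"
      then have w: "(y, w) \<in> ?A" "(z, w) \<in> ?A" by auto
      then have "gdist H x w = 2" using c3[OF V(1,2) 3(1)] by blast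
      then have "card {z \<in> ?A `` {w}. gdist H x z = 3} = 1" using b2[OF V(1)] w A_sub by auto
      then obtain t where "{z \<in> ?A `` {w}. gdist H x z = 3} = {t}" by (rule card_1_singletonE)
      moreover have "y \<in> {z \<in> ?A `` {w}. gdist H x z = 3}" "z \<in> {z \<in> ?A `` {w}. gdist H x z = 3}"
        using w 3 arc_sym by auto
      ultimately show False using False by auto
    qed
    moreover have "(y, z) \<notin> ?A"
    proof
      assume "(y, z) \<in> ?A"
      then have "gdist H x z = 2" using c3[OF V(1,2) 3(1)] by blast
      with 3(2) show False by simp
    qed
    ultimately show ?thesis using S_iff[OF V(2,3)] by blast
  qed
  have dist_cases: "gdist H u w = 2"
    if "u \<in> ?V" "w \<in> ?V" "(u, w) \<notin> ?A" "(u, w) \<notin> ?S" for u w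
    using that S_iff[of u w] gdist_eq_2[of u w] by blast
  show ?thesis
  proof
    show "2 \<le> q" by (rule q)
    show "finite ?V" by (rule pair_finite_verts)
    show "?V \<noteq> {}"
      using dr by (simp add: distance_regular_def Digraph_Component.connected_def strongly_connected_def)
    show "?A \<subseteq> ?V \<times> ?V" by (rule A_sub)
    show "sym ?A" using arc_sym by (rule symI)
    show "equiv ?V ?S"
    proof (rule equivI[OF S_sub])
      show "refl_on ?V ?S" by (auto simp: refl_on_def antipodal_rel_def)
      show "trans ?S" using S_trans S_sym by (meson symD transI)
    qed (rule S_sym)
    show "?A \<inter> ?S = {}" using S_iff A_sub no_loop by blast
  next
    fix x assume x: "x \<in> ?V"
    show "card (?A `` {x}) = q^2 - 1" by (rule deg[OF x])
    define N2 where "N2 = {y \<in> ?V. gdist H x y = 2}"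
    define N3 where "N3 = {y \<in> ?V. gdist H x y = 3}"
    have fin: "finite N2" "finite N3" using pair_finite_verts by (auto simp: N2_def N3_def)
    have "(\<Sum>i\<in>?A `` {x}. card {j \<in> N2. (i, j) \<in> ?A}) = q * card N2"
    proof (rule sum_multicount)
      show "\<forall>j\<in>N2. card {i \<in> ?A `` {x}. (i, j) \<in> ?A} = q"
      proof
        fix j assume j: "j \<in> N2"
        have "{i \<in> ?A `` {x}. (i, j) \<in> ?A} = ?A `` {x} \<inter> ?A `` {j}" using arc_sym by auto
        then show "card {i \<in> ?A `` {x}. (i, j) \<in> ?A} = q" using c2[OF x] j by (simp add: N2_def)
      qed
    qed (use fin finite_neighbours in auto)
    moreover have "card {j \<in> N2. (i, j) \<in> ?A} = q^2 - q" if "i \<in> ?A `` {x}" for i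
    proof -
      have "{j \<in> N2. (i, j) \<in> ?A} = {z \<in> ?A `` {i}. gdist H x z = 2}"
        using A_sub by (auto simp: N2_def)
      then show ?thesis using b1[of x i] that by simp
    qed
    ultimately have k2: "(q^2 - 1) * (q^2 - q) = q * card N2" using deg[OF x] by simp
    have "(\<Sum>i\<in>N2. card {j \<in> N3. (i, j) \<in> ?A}) = (q^2 - 1) * card N3"
    proof (rule sum_multicount)
      show "\<forall>j\<in>N3. card {i \<in> N2. (i, j) \<in> ?A} = q^2 - 1"
      proof
        fix j assume j: "j \<in> N3"
        have "{i \<in> N2. (i, j) \<in> ?A} = {z \<in> ?A `` {j}. gdist H x z = 2}"
          using A_sub arc_sym by (auto simp: N2_def)
        then show "card {i \<in> N2. (i, j) \<in> ?A} = q^2 - 1"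
          using c3[OF x] deg j by (simp add: N3_def)
      qed
    qed (use fin in auto)
    moreover have "card {j \<in> N3. (i, j) \<in> ?A} = 1" if "i \<in> N2" for i
    proof -
      have "{j \<in> N3. (i, j) \<in> ?A} = {z \<in> ?A `` {i}. gdist H x z = 3}"
        using A_sub by (auto simp: N3_def)
      then show ?thesis using b2[OF x] that by (simp add: N2_def)
    qed
    ultimately have "card N2 = (q^2 - 1) * card N3" by simp
    with k2 have "(q * (q^2 - 1)) * (q - 1) = (q * (q^2 - 1)) * card N3"
      by (simp add: power2_eq_square algebra_simps)
    moreover have "q * (q^2 - 1) \<noteq> 0" using q q_lt by simp
    ultimately have "card N3 = q - 1" using mult_cancel1 by metis
    moreover have "?S `` {x} = insert x N3" using x by (auto simp: antipodal_rel_def N3_def)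
    moreover have "x \<notin> N3" using gdist_eq_0[OF x, of x] by (auto simp: N3_def)
    ultimately show "card (?S `` {x}) = q" using fin q by simp
  next
    fix x y assume xy: "(x, y) \<in> ?A"
    then have x: "x \<in> ?V" using A_sub by auto
    have "{z \<in> ?A `` {y}. z \<noteq> x \<and> (x, z) \<notin> ?A} = {z \<in> ?A `` {y}. gdist H x z = 2}"
      unfolding gdist_eq_2[OF x] using xy arc_sym by blast
    then show "card (?A `` {x} \<inter> ?A `` {y}) = q - 2"
      using card_neighbours_split[OF xy] b1[OF xy] deg[of y] xy A_sub q_lt by auto
  next
    fix x y assume "x \<in> ?V" "y \<in> ?V" "(x, y) \<notin> ?A" "(x, y) \<notin> ?S"
    then show "card (?A `` {x} \<inter> ?A `` {y}) = q" using c2 dist_cases by blast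
  next
    fix x y assume "(x, y) \<in> ?S" "x \<noteq> y"
    then show "?A `` {x} \<inter> ?A `` {y} = {}" using S_iff S_sub by blast
  next
    fix x y assume xy: "x \<in> ?V" "y \<in> ?V" "(x, y) \<notin> ?S"
    show "\<exists>!z. (x, z) \<in> ?A \<and> (z, y) \<in> ?S"
    proof (cases "(x, y) \<in> ?A")
      case True
      have "(y, y) \<in> ?S" using xy by (simp add: antipodal_rel_def)
      moreover have "z = y" if "(x, z) \<in> ?A" "(z, y) \<in> ?S" for z
        using that True S_iff[of z y] xy A_sub arc_sym by blast
      ultimately show ?thesis using True by blast
    next
      case False
      have "gdist H y x = 2"
        using dist_cases[of y x] xy False S_sym arc_sym by (blast dest: symD)
      then have "card {z \<in> ?A `` {x}. gdist H y z = 3} = 1" using b2 xy by blast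
      then obtain t where "{z \<in> ?A `` {x}. gdist H y z = 3} = {t}" by (rule card_1_singletonE)
      moreover have "(x, z) \<in> ?A \<and> (z, y) \<in> ?S \<longleftrightarrow> z \<in> {z \<in> ?A `` {x}. gdist H y z = 3}" for z
        using False xy A_sub S_sym by (auto simp: antipodal_rel_def dest: symD)
      ultimately have "(x, z) \<in> ?A \<and> (z, y) \<in> ?S \<longleftrightarrow> z = t" for z by blast
      then show ?thesis by simp
    qed
  qed
qed

lemma antipodal_cover_imp_distance_regular:
  assumes "pair_graph H" and "antipodal_cover q (pverts H) (parcs H) S"
  shows "distance_regular H [q^2 - 1, q^2 - q, 1] [1, q, q^2 - 1]"
    and "antipodal_rel H = S"
proof -
  interpret pair_graph H by fact
  interpret antipodal_cover q "pverts H" "parcs H" S by fact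
  let ?V = "pverts H" and ?A = "parcs H"
  have reach: "\<exists>n\<le>3. (u, w) \<in> ?A ^^ n" if uw: "u \<in> ?V" "w \<in> ?V" for u w
  proof -
    consider "u = w" | "(u, w) \<in> ?A" | "?A `` {u} \<inter> ?A `` {w} \<noteq> {}" | "(u, w) \<in> S" "u \<noteq> w"
      using in_S_iff[OF uw] by blast
    then show ?thesis
    proof cases
      case 1
      then show ?thesis by (intro exI[of _ 0]) simp
    next
      case 2
      then show ?thesis by (intro exI[of _ 1]) simp
    next
      case 3
      then have "(u, w) \<in> ?A ^^ 2" using arc_sym by (auto simp: numeral_2_eq_2)
      then show ?thesis by (intro exI[of _ 2]) simp
    next
      case 4
      then show ?thesis using relpow_3 by blast
    qed
  qed
  have le3: "gdist H u w \<le> 3" if uw: "u \<in> ?V" "w \<in> ?V" for u w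
  proof -
    obtain n where n: "n \<le> 3" "(u, w) \<in> ?A ^^ n" using reach[OF uw] by blast
    have "gdist H u w \<le> ereal (real n)" by (rule gdist_le[OF pair_wf_digraph uw(1) n(2)])
    also have "\<dots> \<le> 3" using n(1) by simp
    finally show ?thesis .
  qed
  have d2: "gdist H u w = 2 \<longleftrightarrow> (u, w) \<notin> ?A \<and> (u, w) \<notin> S" if "u \<in> ?V" "w \<in> ?V" for u w
    unfolding gdist_eq_2[OF that(1)] in_S_iff[OF that] by blast
  have d3: "gdist H u w = 3 \<longleftrightarrow> (u, w) \<in> S \<and> u \<noteq> w" if "u \<in> ?V" "w \<in> ?V" for u w
    unfolding gdist_eq_3[OF that(1) le3[OF that]] in_S_iff[OF that] by blast
  show "antipodal_rel H = S"
    using d3 S_subset S_refl unfolding antipodal_rel_def by blast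
  have "\<exists>n. (u, w) \<in> ?A ^^ n" if "u \<in> ?V" "w \<in> ?V" for u w using reach[OF that] by blast
  then have connected: "Digraph_Component.connected (with_proj H)"
    by (rule symmetric_reachable_imp_connected[OF X_nonempty])
  have diameter: "diameter H = ereal (real 3)"
  proof (rule antisym)
    show "diameter H \<le> ereal (real 3)"
      unfolding diameter_def by (rule SUP_least) (use le3 in auto)
    obtain x where x: "x \<in> ?V" using X_nonempty by blast
    have "\<not> S `` {x} \<subseteq> {x}" using card_fibre[OF x] q_ge_2 card_mono[of "{x}" "S `` {x}"] by auto
    then obtain y where y: "(x, y) \<in> S" "x \<noteq> y" by blast
    have yV: "y \<in> ?V" using y S_subset by auto
    have "gdist H x y = 3" using d3[OF x yV] y by simp
    then show "ereal (real 3) \<le> diameter H"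
      unfolding diameter_def using x yV by (intro SUP_upper2[of "(x, y)"]) auto
  qed
  have counts: "(gdist H u w = ereal (real i) \<longrightarrow>
       card {z \<in> ?A `` {w}. gdist H u z = ereal (real (i + 1))} = [q^2 - 1, q^2 - q, 1] ! i) \<and>
      (gdist H u w = ereal (real (i + 1)) \<longrightarrow>
       card {z \<in> ?A `` {w}. gdist H u z = ereal (real i)} = [1, q, q^2 - 1] ! i)"
    if u: "u \<in> ?V" and w: "w \<in> ?V" and i: "i < 3" for u w i
  proof -
    have V: "z \<in> ?V" if "z \<in> ?A `` {w}" for z using that A_subset by auto
    have e: "ereal (real 1) = 1" "ereal (real (0 + 1)) = 1" "ereal (real (1 + 1)) = 2"
      "ereal (real 2) = 2" "ereal (real (2 + 1)) = 3" "ereal (real 0) = 0" by simp_all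
    have b1: "card {z \<in> ?A `` {w}. gdist H u z = 2} = q^2 - q" if uw: "(u, w) \<in> ?A"
    proof -
      have "{z \<in> ?A `` {w}. gdist H u z = 2} = {z \<in> ?A `` {w}. z \<noteq> u \<and> (u, z) \<notin> ?A}"
        unfolding gdist_eq_2[OF u] using uw arc_sym by blast
      then show ?thesis
        using card_neighbours_split[OF uw] adjacent_common[OF uw] degree[OF w] q_ge_2 q_squares by simp
    qed
    have c1: "{z \<in> ?A `` {w}. gdist H u z = 0} = {u}" if "(u, w) \<in> ?A"
      using that arc_sym by (auto simp: gdist_eq_0[OF u])
    have b2: "card {z \<in> ?A `` {w}. gdist H u z = 3} = 1" if "(u, w) \<notin> ?A" "(u, w) \<notin> S"
    proof -
      have "(w, u) \<notin> S" using that(2) S_symD by blast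
      then obtain t where t: "(w, t) \<in> ?A" "(t, u) \<in> S"
        and uniq: "\<And>z. (w, z) \<in> ?A \<Longrightarrow> (z, u) \<in> S \<Longrightarrow> z = t"
        using matching[OF w u] by blast
      have "z \<in> ?A `` {w} \<and> gdist H u z = 3 \<longleftrightarrow> z = t" for z
      proof (cases "z \<in> ?A `` {w}")
        case True
        moreover have "u \<noteq> z" using True that(1) arc_sym by blast
        ultimately show ?thesis using d3[OF u V[OF True]] t(2) uniq S_symD by blast
      next
        case False
        then show ?thesis using t(1) by blast
      qed
      then show ?thesis by simp
    qed
    have c2: "card {z \<in> ?A `` {w}. gdist H u z = 1} = q" if "(u, w) \<notin> ?A" "(u, w) \<notin> S"
    proof -
      have "{z \<in> ?A `` {w}. gdist H u z = 1} = ?A `` {u} \<inter> ?A `` {w}"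
        by (auto simp: gdist_eq_1[OF u])
      then show ?thesis using distance_2_common[OF u w that] by simp
    qed
    have c3: "{z \<in> ?A `` {w}. gdist H u z = 2} = ?A `` {w}" if "(u, w) \<in> S" "u \<noteq> w"
    proof -
      have "gdist H u z = 2" if z: "z \<in> ?A `` {w}" for z
      proof -
        have "(u, z) \<notin> ?A" using fibre_common[OF \<open>(u, w) \<in> S\<close> \<open>u \<noteq> w\<close>] z by blast
        moreover have "(u, z) \<notin> S"
          using S_trans[OF S_symD[OF \<open>(u, w) \<in> S\<close>], of z] z A_S_disjoint by blast
        ultimately show ?thesis using d2[OF u V[OF z]] by blast
      qed
      then show ?thesis by blast
    qed
    have "{z \<in> ?A `` {w}. gdist H w z = 1} = ?A `` {w}"
      by (auto simp: gdist_eq_1[OF w])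
    then have b0: "card {z \<in> ?A `` {w}. gdist H w z = 1} = q^2 - 1" by (simp add: degree[OF w])
    consider "i = 0" | "i = 1" | "i = 2" using i by linarith
    then show ?thesis
    proof cases
      case 1
      show ?thesis unfolding 1 e gdist_eq_0[OF u, of w] gdist_eq_1[OF u, of w]
        using b0 c1 by simp
    next
      case 2
      show ?thesis unfolding 2 e gdist_eq_1[OF u, of w] d2[OF u w] using b1 c2 by simp
    next
      case 3
      show ?thesis unfolding 3 e d2[OF u w] d3[OF u w] using b2 c3 degree[OF w] by simp
    qed
  qed
  show "distance_regular H [q^2 - 1, q^2 - q, 1] [1, q, q^2 - 1]"
    unfolding distance_regular_def using connected diameter counts \<open>pair_graph H\<close>
    by (simp add: numeral_3_eq_3)
qed

section \<open>Affine planes as designs\<close>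

lemma card_eq_1_iff_unique: "card {x. P x} = 1 \<longleftrightarrow> (\<exists>!x. P x)"
  using is_singleton_altdef[of "{x. P x}"] is_singleton_iff_ex1[of "{x. P x}"] by simp

text \<open>
  A \<open>2-(q\<^sup>2, q, 1)\<close> design. Its axioms are statements about common neighbours in the graphs below, while
  the parallel postulate is not; so the postulate and the number of parallels are derived from them
  by counting.
\<close>

locale plane_design =
  fixes q :: nat and I :: "('p, 'l) incidence_structure"
  assumes order_ge_2: "2 \<le> q" and finite_points: "finite (points I)"
    and card_points_I: "card (points I) = q^2"
    and card_line: "l \<in> lines I \<Longrightarrow> card {p \<in> points I. inc I p l} = q"
    and unique_line: "p \<in> points I \<Longrightarrow> p' \<in> points I \<Longrightarrow> p \<noteq> p' \<Longrightarrow>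
      \<exists>!l. l \<in> lines I \<and> inc I p l \<and> inc I p' l"
begin

abbreviation pts :: "'l \<Rightarrow> 'p set" where
  "pts l \<equiv> {p \<in> points I. inc I p l}"

abbreviation parallels :: "'l \<Rightarrow> 'l set" where
  "parallels l \<equiv> {m \<in> lines I. parallel I l m}"

lemma line_through:
  assumes "p \<in> points I" "p' \<in> points I" "p \<noteq> p'"
  obtains l where "l \<in> lines I" "inc I p l" "inc I p' l"
    "\<And>m. m \<in> lines I \<Longrightarrow> inc I p m \<Longrightarrow> inc I p' m \<Longrightarrow> m = l"
  using ex1E[OF unique_line[OF assms]] by metis

text \<open>Two points span at most one line, and a line has at least two points.\<close>

lemma pts_inj: "inj_on pts (lines I)"
proof (rule inj_onI)
  fix l m assume lm: "l \<in> lines I" "m \<in> lines I" "pts l = pts m"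
  have "\<not> card (pts l) \<le> Suc 0" using card_line[OF lm(1)] order_ge_2 by simp
  moreover have "finite (pts l)" using finite_points by simp
  ultimately obtain p p' where p: "p \<in> pts l" "p' \<in> pts l" "p \<noteq> p'"
    unfolding card_le_Suc0_iff_eq[OF \<open>finite (pts l)\<close>] by blast
  have "p \<in> pts m" "p' \<in> pts m" using p lm(3) by simp_all
  with p lm(1,2) show "l = m" using unique_line[of p p'] by auto
qed

lemma finite_lines: "finite (lines I)"
proof (rule finite_imageD[OF finite_subset pts_inj])
  show "pts ` lines I \<subseteq> Pow (points I)" by auto
  show "finite (Pow (points I))" using finite_points by simp
qed

text \<open>Each of the other points lies on exactly one line through \<open>p\<close>.\<close>

lemma card_pencil:
  assumes p: "p \<in> points I"
  shows "card {l \<in> lines I. inc I p l} = q + 1"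
proof -
  let ?L = "{l \<in> lines I. inc I p l}"
  have "(\<Sum>t\<in>points I - {p}. card {l \<in> ?L. inc I t l}) = (q - 1) * card ?L"
  proof (rule sum_multicount)
    show "\<forall>l\<in>?L. card {t \<in> points I - {p}. inc I t l} = q - 1"
    proof
      fix l assume l: "l \<in> ?L"
      have "{t \<in> points I - {p}. inc I t l} = pts l - {p}" by auto
      then show "card {t \<in> points I - {p}. inc I t l} = q - 1"
        using l p card_line[of l] finite_points by simp
    qed
  qed (use finite_points finite_lines in auto)
  moreover have "card {l \<in> ?L. inc I t l} = 1" if "t \<in> points I - {p}" for t
  proof -
    have "t \<in> points I" "p \<noteq> t" using that by auto
    then obtain l where l: "l \<in> lines I" "inc I p l" "inc I t l"
      and uniq: "\<And>m. m \<in> lines I \<Longrightarrow> inc I p m \<Longrightarrow> inc I t m \<Longrightarrow> m = l"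
      using line_through[OF p] by blast
    have "{l \<in> ?L. inc I t l} = {l}"
      using l uniq by blast
    then show ?thesis by simp
  qed
  moreover have "card (points I - {p}) = (q - 1) * (q + 1)"
  proof -
    obtain k where "q = Suc k" using order_ge_2 by (cases q) auto
    then show ?thesis using p finite_points card_points_I by (simp add: power2_eq_square)
  qed
  ultimately have "(q - 1) * (q + 1) = (q - 1) * card ?L" by simp
  moreover have "q - 1 \<noteq> 0" using order_ge_2 by simp
  ultimately show ?thesis using mult_cancel1 by metis
qed

lemma meet_at_most_once:
  assumes "l \<in> lines I" "m \<in> lines I" "l \<noteq> m" "p \<in> pts l" "p \<in> pts m" "p' \<in> pts l" "p' \<in> pts m"
  shows "p = p'"
proof (rule ccontr)
  assume "p \<noteq> p'"
  then show False using line_through[of p p'] assms by blast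
qed

text \<open>
  Of the \<open>q + 1\<close> lines through a point off \<open>l\<close>, exactly one meets \<open>l\<close> at each of its \<open>q\<close> points.
\<close>

lemma playfair:
  assumes l: "l \<in> lines I" and p: "p \<in> points I" "\<not> inc I p l"
  shows "\<exists>!m. m \<in> lines I \<and> inc I p m \<and> parallel I l m"
proof -
  let ?L = "{m \<in> lines I. inc I p m}" and ?M = "{m \<in> lines I. inc I p m \<and> \<not> parallel I l m}"
  have "(\<Sum>t\<in>pts l. card {m \<in> ?M. inc I t m}) = 1 * card ?M"
  proof (rule sum_multicount)
    show "\<forall>m\<in>?M. card {t \<in> pts l. inc I t m} = 1"
    proof
      fix m assume m: "m \<in> ?M"
      then obtain t where t: "t \<in> pts l" "t \<in> pts m" by (auto simp: parallel_def)
      have "l \<noteq> m" using m p by auto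
      then have "{t \<in> pts l. inc I t m} = {t}"
        using t meet_at_most_once[OF l, of m t] m by blast
      then show "card {t \<in> pts l. inc I t m} = 1" by simp
    qed
  qed (use finite_points finite_lines in auto)
  moreover have "card {m \<in> ?M. inc I t m} = 1" if t: "t \<in> pts l" for t
  proof -
    have "t \<in> points I" "p \<noteq> t" using t p by auto
    then obtain m where m: "m \<in> lines I" "inc I p m" "inc I t m"
      and uniq: "\<And>m'. m' \<in> lines I \<Longrightarrow> inc I p m' \<Longrightarrow> inc I t m' \<Longrightarrow> m' = m"
      using line_through[OF p(1)] by blast
    have "m \<in> ?M" using m t p unfolding parallel_def by blast
    then have "{m \<in> ?M. inc I t m} = {m}" using m uniq by blast
    then show ?thesis by simp
  qed
  ultimately have "card ?M = q" using card_line[OF l] by simp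
  moreover have "?M \<subseteq> ?L" by auto
  ultimately have "card (?L - ?M) = 1"
    using card_pencil[OF p(1)] finite_lines by (simp add: card_Diff_subset)
  then obtain m where m: "?L - ?M = {m}" by (rule card_1_singletonE)
  have "m' \<in> lines I \<and> inc I p m' \<and> parallel I l m' \<longleftrightarrow> m' \<in> ?L - ?M" for m' by blast
  then show ?thesis unfolding m by simp
qed

lemma affine_plane: "affine_plane_of_order I q"
  unfolding affine_plane_of_order_def affine_plane_def
proof (intro conjI ballI impI)
  have "q < card (points I)" using card_points_I order_ge_2 by (simp add: power2_eq_square)
  then have "\<not> card (points I) \<le> Suc 0" using order_ge_2 by simp
  then obtain p p' where pp': "p \<in> points I" "p' \<in> points I" "p \<noteq> p'"
    unfolding card_le_Suc0_iff_eq[OF finite_points] by blast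
  then obtain l where l: "l \<in> lines I" "inc I p l" "inc I p' l"
    and uniq: "\<And>m. m \<in> lines I \<Longrightarrow> inc I p m \<Longrightarrow> inc I p' m \<Longrightarrow> m = l"
    using line_through[OF pp'] by blast
  have "card (pts l) < card (points I)"
    using card_line[OF l(1)] card_points_I order_ge_2 by (simp add: power2_eq_square)
  then have "points I \<noteq> pts l" by auto
  then obtain p'' where p'': "p'' \<in> points I" "\<not> inc I p'' l" by auto
  show "\<exists>p\<in>points I. \<exists>p'\<in>points I. \<exists>p''\<in>points I. distinct [p, p', p''] \<and>
        \<not> (\<exists>l\<in>lines I. inc I p l \<and> inc I p' l \<and> inc I p'' l)"
  proof (intro bexI conjI)
    show "distinct [p, p', p'']" using pp' p'' l by auto
    show "\<not> (\<exists>l\<in>lines I. inc I p l \<and> inc I p' l \<and> inc I p'' l)" using p'' uniq by blast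
  qed (use pp' p'' in simp_all)
qed (use unique_line playfair card_line in auto)

lemma parallel_sym: "parallel I l m \<Longrightarrow> parallel I m l"
  by (auto simp: parallel_def)

lemma parallel_trans:
  assumes L: "l \<in> lines I" "m \<in> lines I" "n \<in> lines I" and "parallel I l m" "parallel I m n"
  shows "parallel I l n"
proof (rule ccontr)
  assume "\<not> parallel I l n"
  then obtain p where p: "l \<noteq> n" "p \<in> points I" "inc I p l" "inc I p n"
    by (auto simp: parallel_def)
  show False
  proof (cases "inc I p m")
    case True
    then show False using p assms by (auto simp: parallel_def)
  next
    case False
    have "l \<in> lines I \<and> inc I p l \<and> parallel I m l" "n \<in> lines I \<and> inc I p n \<and> parallel I m n"
      using p L assms(4,5) parallel_sym by simp_all
    then show False using playfair[OF L(2) p(2) False] p(1) by blast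
  qed
qed

text \<open>
  So the parallels of a line partition the points, and there are \<open>q\<^sup>2 / q\<close> of them.
\<close>

lemma parallel_through_unique:
  assumes l: "l \<in> lines I" and p: "p \<in> points I"
  shows "\<exists>!m. m \<in> parallels l \<and> inc I p m"
proof (cases "inc I p l")
  case True
  then have "m \<in> parallels l \<and> inc I p m \<longleftrightarrow> m = l" for m
    using l p by (auto simp: parallel_def)
  then show ?thesis by simp
next
  case False
  then show ?thesis using playfair[OF l p] by (simp add: conj_ac)
qed

lemma card_parallels_through:
  assumes "l \<in> lines I" "p \<in> points I"
  shows "card {m \<in> parallels l. inc I p m} = 1"
proof -
  show ?thesis
    unfolding card_eq_1_iff_unique by (rule parallel_through_unique[OF assms])
qed

lemma card_parallels:
  assumes l: "l \<in> lines I"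
  shows "card (parallels l) = q"
proof -
  have "(\<Sum>p\<in>points I. card {m \<in> parallels l. inc I p m}) = q * card (parallels l)"
    by (rule sum_multicount) (use finite_points finite_lines card_line in auto)
  then have "q * q = q * card (parallels l)"
    using card_parallels_through[OF l] by (simp add: card_points_I power2_eq_square)
  then show ?thesis using order_ge_2 by simp
qed

lemma card_lines: "card (lines I) = q^2 + q"
proof -
  have "(\<Sum>p\<in>points I. card {m \<in> lines I. inc I p m}) = q * card (lines I)"
    by (rule sum_multicount) (use finite_points finite_lines card_line in auto)
  then have "q * (q^2 + q) = q * card (lines I)"
    using card_pencil by (simp add: card_points_I power2_eq_square algebra_simps)
  then show ?thesis using order_ge_2 by simp
qed

end

lemma plane_design_of_affine_plane:
  assumes "affine_plane_of_order I q" "2 \<le> q" "finite (points I)" "card (points I) = q^2"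
  shows "plane_design q I"
  using assms unfolding affine_plane_of_order_def affine_plane_def
  by unfold_locales blast+

section \<open>Matrices\<close>

lemma mat_mult_assoc: "mat_mult X (mat_mult X A B) C = mat_mult X A (mat_mult X B C)"
proof (intro ext)
  fix x y
  have "mat_mult X (mat_mult X A B) C x y = (\<Sum>z\<in>X. \<Sum>w\<in>X. A x w * B w z * C z y)"
    by (simp add: mat_mult_def sum_distrib_right)
  also have "\<dots> = (\<Sum>w\<in>X. \<Sum>z\<in>X. A x w * B w z * C z y)" by (rule sum.swap)
  finally show "mat_mult X (mat_mult X A B) C x y = mat_mult X A (mat_mult X B C) x y"
    by (simp add: mat_mult_def sum_distrib_left mult.assoc)
qed

lemma mat_mult_lin_comb_left:
  "mat_mult X (lin_comb J c M) B = lin_comb J c (\<lambda>j. mat_mult X (M j) B)"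
proof (intro ext)
  fix x y
  have "mat_mult X (lin_comb J c M) B x y = (\<Sum>z\<in>X. \<Sum>j\<in>J. c j * (M j x z * B z y))"
    by (simp add: mat_mult_def lin_comb_def sum_distrib_right mult.assoc)
  also have "\<dots> = (\<Sum>j\<in>J. \<Sum>z\<in>X. c j * (M j x z * B z y))" by (rule sum.swap)
  finally show "mat_mult X (lin_comb J c M) B x y = lin_comb J c (\<lambda>j. mat_mult X (M j) B) x y"
    by (simp add: mat_mult_def lin_comb_def sum_distrib_left)
qed

lemma mat_mult_lin_comb_right:
  "mat_mult X B (lin_comb J c M) = lin_comb J c (\<lambda>j. mat_mult X B (M j))"
proof (intro ext)
  fix x y
  have "mat_mult X B (lin_comb J c M) x y = (\<Sum>z\<in>X. \<Sum>j\<in>J. c j * (B x z * M j z y))"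
    by (simp add: mat_mult_def lin_comb_def sum_distrib_left mult_ac)
  also have "\<dots> = (\<Sum>j\<in>J. \<Sum>z\<in>X. c j * (B x z * M j z y))" by (rule sum.swap)
  finally show "mat_mult X B (lin_comb J c M) x y = lin_comb J c (\<lambda>j. mat_mult X B (M j)) x y"
    by (simp add: mat_mult_def lin_comb_def sum_distrib_left)
qed

lemma lin_comb_lin_comb:
  "lin_comb J c (\<lambda>j. lin_comb K (d j) M) = lin_comb K (\<lambda>k. \<Sum>j\<in>J. c j * d j k) M"
proof (intro ext)
  fix x y
  have "lin_comb J c (\<lambda>j. lin_comb K (d j) M) x y = (\<Sum>j\<in>J. \<Sum>k\<in>K. c j * d j k * M k x y)"
    by (simp add: lin_comb_def sum_distrib_left mult.assoc)
  also have "\<dots> = (\<Sum>k\<in>K. \<Sum>j\<in>J. c j * d j k * M k x y)" by (rule sum.swap)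
  finally show "lin_comb J c (\<lambda>j. lin_comb K (d j) M) x y =
      lin_comb K (\<lambda>k. \<Sum>j\<in>J. c j * d j k) M x y"
    by (simp add: lin_comb_def sum_distrib_right)
qed

lemma lin_comb_cong:
  "(\<And>j. j \<in> J \<Longrightarrow> c j = d j) \<Longrightarrow> (\<And>j. j \<in> J \<Longrightarrow> M j = N j) \<Longrightarrow> lin_comb J c M = lin_comb J d N"
  by (simp add: lin_comb_def)

lemma lin_comb_delta:
  assumes "finite J" "i \<in> J"
  shows "lin_comb J (\<lambda>j. of_bool (j = i)) M = M i"
  using assms by (simp add: lin_comb_def of_bool_def if_distrib[of "\<lambda>c. c * _"] cong: if_cong)

lemma mat_mult_rel_mat:
  assumes "finite X"
  shows "mat_mult X (rel_mat r) (rel_mat s) x y = real (card {z \<in> X. (x, z) \<in> r \<and> (z, y) \<in> s})"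
proof -
  have "mat_mult X (rel_mat r) (rel_mat s) x y = (\<Sum>z\<in>X. of_bool ((x, z) \<in> r \<and> (z, y) \<in> s))"
    by (simp add: mat_mult_def rel_mat_def of_bool_conj)
  also have "\<dots> = real (card (X \<inter> {z. (x, z) \<in> r \<and> (z, y) \<in> s}))"
    using assms by simp
  finally show ?thesis by (simp add: Int_def)
qed

lemma lin_comb_rel_mat_entry:
  assumes "\<And>i j. i \<in> J \<Longrightarrow> j \<in> J \<Longrightarrow> i \<noteq> j \<Longrightarrow> R i \<inter> R j = {}"
    and "finite J" "k \<in> J" "(x, y) \<in> R k"
  shows "lin_comb J c (\<lambda>j. rel_mat (R j)) x y = c k"
proof -
  have "c j * rel_mat (R j) x y = (if j = k then c k else 0)" if "j \<in> J" for j
    using assms(1)[OF that assms(3)] assms(4) by (auto simp: rel_mat_def)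
  then have "lin_comb J c (\<lambda>j. rel_mat (R j)) x y = (\<Sum>j\<in>J. if j = k then c k else 0)"
    unfolding lin_comb_def by (rule sum.cong[OF refl])
  then show ?thesis using assms(2,3) by simp
qed

text \<open>
  On each common eigenspace a product of relation matrices acts as the product of the eigenvalues, so
  the intersection numbers are read off the first eigenmatrix.
\<close>

lemma first_eigenmatrix_product:
  assumes P: "first_eigenmatrix X d R P" and ij: "i \<le> d" "j \<le> d"
    and c: "\<And>e. e \<le> d \<Longrightarrow> P e i * P e j = (\<Sum>k\<le>d. c k * P e k)"
  shows "mat_mult X (rel_mat (R i)) (rel_mat (R j)) = lin_comb {..d} c (\<lambda>k. rel_mat (R k))"
proof -
  obtain E where E: "primitive_idempotents X d R E"
    and R: "\<And>j. j \<le> d \<Longrightarrow> rel_mat (R j) = lin_comb {..d} (\<lambda>e. P e j) E"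
    using P unfolding first_eigenmatrix_def by blast
  have row: "lin_comb {..d} (\<lambda>f. P f j) (\<lambda>f. mat_mult X (E e) (E f)) =
      lin_comb {e} (\<lambda>e. P e j) E" if e: "e \<le> d" for e
  proof (intro ext)
    fix x y
    have "P f j * mat_mult X (E e) (E f) x y = (if f = e then P e j * E e x y else 0)" if "f \<le> d" for f
      using E e that unfolding primitive_idempotents_def by auto
    then have "lin_comb {..d} (\<lambda>f. P f j) (\<lambda>f. mat_mult X (E e) (E f)) x y =
        (\<Sum>f\<le>d. if f = e then P e j * E e x y else 0)"
      unfolding lin_comb_def by (intro sum.cong) auto
    then show "lin_comb {..d} (\<lambda>f. P f j) (\<lambda>f. mat_mult X (E e) (E f)) x y =
        lin_comb {e} (\<lambda>e. P e j) E x y"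
      using e by (simp add: lin_comb_def)
  qed
  have "mat_mult X (rel_mat (R i)) (rel_mat (R j)) =
      lin_comb {..d} (\<lambda>e. P e i) (\<lambda>e. mat_mult X (E e) (lin_comb {..d} (\<lambda>f. P f j) E))"
    unfolding R[OF ij(1)] R[OF ij(2)] by (rule mat_mult_lin_comb_left)
  also have "\<dots> = lin_comb {..d} (\<lambda>e. P e i) (\<lambda>e. lin_comb {e} (\<lambda>e. P e j) E)"
    by (rule lin_comb_cong) (simp_all add: mat_mult_lin_comb_right row)
  also have "\<dots> = lin_comb {..d} (\<lambda>e. \<Sum>k\<le>d. c k * P e k) E"
    using c by (simp add: lin_comb_def flip: mult.assoc)
  also have "\<dots> = lin_comb {..d} c (\<lambda>k. lin_comb {..d} (\<lambda>e. P e k) E)"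
    by (rule lin_comb_lin_comb[symmetric])
  also have "\<dots> = lin_comb {..d} c (\<lambda>k. rel_mat (R k))"
    by (rule lin_comb_cong) (simp_all add: R)
  finally show ?thesis .
qed

section \<open>The scheme of an antipodal cover\<close>

lemma sum_upto_3: "(\<Sum>k\<le>3. f k) = f 0 + f 1 + f 2 + f (3::nat)" for f :: "nat \<Rightarrow> real"
  by (simp add: numeral_3_eq_3 numeral_2_eq_2)

lemma le_3_cases:
  assumes "k \<le> (3::nat)" obtains "k = 0" | "k = 1" | "k = 2" | "k = 3"
  using assms by linarith

text \<open>
  Three products suffice: \<open>B\<^sub>1\<^sup>2 = (q\<^sup>2 - 1) I + (q - 2) B\<^sub>1 + q B\<^sub>2\<close> gives the numbers of common neighbours,
  \<open>B\<^sub>1 B\<^sub>3 = B\<^sub>2\<close> the matchings between fibres, and \<open>B\<^sub>3\<^sup>2 = (q - 1) I + (q - 2) B\<^sub>3\<close> shows that the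
  fibres are classes of an equivalence relation, of size \<open>q\<close>.
\<close>

lemma scheme_imp_antipodal_cover:
  assumes q: "2 \<le> q" and scheme: "assoc_scheme X 3 R"
    and P: "first_eigenmatrix X 3 R (regular_point_matrix (real q))"
  shows "antipodal_cover q X (R 1) (Id_on X \<union> R 3)"
proof -
  let ?A = "R 1" and ?S = "Id_on X \<union> R 3"
  have fin: "finite X" and R0: "R 0 = Id_on X"
    and ne: "\<And>i. i \<le> 3 \<Longrightarrow> R i \<noteq> {}" and sym: "\<And>i. i \<le> 3 \<Longrightarrow> sym (R i)"
    and un: "(\<Union>i\<le>3. R i) = X \<times> X"
    and disj: "\<And>i j. i \<le> 3 \<Longrightarrow> j \<le> 3 \<Longrightarrow> i \<noteq> j \<Longrightarrow> R i \<inter> R j = {}"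
    using scheme by (auto simp: assoc_scheme_def)
  have sub: "R i \<subseteq> X \<times> X" if "i \<le> 3" for i using un that by blast
  have symD: "(y, x) \<in> R i" if "i \<le> 3" "(x, y) \<in> R i" for i x y
    using sym that by (auto dest: symD)
  have count: "real (card {z \<in> X. (x, z) \<in> R i \<and> (z, y) \<in> R j}) = c k"
    if ij: "i \<le> 3" "j \<le> 3"
      and c: "\<And>e. e \<le> 3 \<Longrightarrow> regular_point_matrix (real q) e i * regular_point_matrix (real q) e j =
        (\<Sum>k\<le>3. c k * regular_point_matrix (real q) e k)"
      and k: "k \<le> 3" "(x, y) \<in> R k" for i j c k x y
  proof -
    have "real (card {z \<in> X. (x, z) \<in> R i \<and> (z, y) \<in> R j}) =
        lin_comb {..3} c (\<lambda>k. rel_mat (R k)) x y"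
      unfolding mat_mult_rel_mat[OF fin, symmetric]
      by (rule fun_cong[OF fun_cong[OF first_eigenmatrix_product[OF P ij]]]) (rule c)
    also have "\<dots> = c k" by (rule lin_comb_rel_mat_entry) (use disj k in auto)
    finally show ?thesis .
  qed
  have N11: "real (card {z \<in> X. (x, z) \<in> R 1 \<and> (z, y) \<in> R 1}) =
      [real q ^ 2 - 1, real q - 2, real q, 0] ! k" if "k \<le> 3" "(x, y) \<in> R k" for k x y
  proof (rule count[OF _ _ _ that])
    fix e :: nat assume "e \<le> 3"
    then show "regular_point_matrix (real q) e 1 * regular_point_matrix (real q) e 1 =
        (\<Sum>k\<le>3. [real q ^ 2 - 1, real q - 2, real q, 0] ! k * regular_point_matrix (real q) e k)"
      by (cases rule: le_3_cases)
        (simp_all add: regular_point_matrix_def sum_upto_3 power2_eq_square algebra_simps)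
  qed auto
  have N13: "real (card {z \<in> X. (x, z) \<in> R 1 \<and> (z, y) \<in> R 3}) = [0, 0, 1, 0] ! k"
    if "k \<le> 3" "(x, y) \<in> R k" for k x y
  proof (rule count[OF _ _ _ that])
    fix e :: nat assume "e \<le> 3"
    then show "regular_point_matrix (real q) e 1 * regular_point_matrix (real q) e 3 =
        (\<Sum>k\<le>3. [0, 0, 1, 0] ! k * regular_point_matrix (real q) e k)"
      by (cases rule: le_3_cases)
        (simp_all add: regular_point_matrix_def sum_upto_3 power2_eq_square algebra_simps)
  qed auto
  have N33: "real (card {z \<in> X. (x, z) \<in> R 3 \<and> (z, y) \<in> R 3}) = [real q - 1, 0, 0, real q - 2] ! k"
    if "k \<le> 3" "(x, y) \<in> R k" for k x y
  proof (rule count[OF _ _ _ that])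
    fix e :: nat assume "e \<le> 3"
    then show "regular_point_matrix (real q) e 3 * regular_point_matrix (real q) e 3 =
        (\<Sum>k\<le>3. [real q - 1, 0, 0, real q - 2] ! k * regular_point_matrix (real q) e k)"
      by (cases rule: le_3_cases)
        (simp_all add: regular_point_matrix_def sum_upto_3 power2_eq_square algebra_simps)
  qed auto
  have Int: "{z \<in> X. (x, z) \<in> R 1 \<and> (z, y) \<in> R 1} = R 1 `` {x} \<inter> R 1 `` {y}" for x y
    using sub[of 1] symD[of 1] by auto
  have diag: "(x, x) \<in> R 0" if "x \<in> X" for x using that R0 by auto
  have total: "\<exists>k\<le>3. (x, y) \<in> R k" if "x \<in> X" "y \<in> X" for x y using un that by blast
  show ?thesis
  proof
    show "2 \<le> q" "finite X" by fact+
    show "X \<noteq> {}" using ne[of 0] R0 by auto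
    show "?A \<subseteq> X \<times> X" "sym ?A" using sub sym by auto
    show "?A \<inter> ?S = {}" using disj[of 1 0] disj[of 1 3] R0 by auto
    show "equiv X ?S"
    proof (rule equivI)
      show "?S \<subseteq> X \<times> X" using sub[of 3] by auto
      show "refl_on X ?S" by (auto simp: refl_on_def)
      show "sym ?S" using sym[of 3] by (auto simp: sym_def)
      show "trans ?S"
      proof (rule transI)
        fix x y z assume xyz: "(x, y) \<in> ?S" "(y, z) \<in> ?S"
        show "(x, z) \<in> ?S"
        proof (cases "(x, y) \<in> R 3 \<and> (y, z) \<in> R 3")
          case True
          then have V: "x \<in> X" "y \<in> X" "z \<in> X" using sub[of 3] by auto
          obtain k where k: "k \<le> 3" "(x, z) \<in> R k" using total[OF V(1,3)] by blast
          have "y \<in> {w \<in> X. (x, w) \<in> R 3 \<and> (w, z) \<in> R 3}" using True V by auto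
          then have "card {w \<in> X. (x, w) \<in> R 3 \<and> (w, z) \<in> R 3} \<noteq> 0" using fin by auto
          then have nonzero: "[real q - 1, 0, 0, real q - 2] ! k \<noteq> 0"
            unfolding N33[OF k, symmetric] by simp
          have "k = 0 \<or> k = 3" by (rule le_3_cases[OF k(1)]) (use nonzero in auto)
          then show ?thesis using k R0 by auto
        qed (use xyz in auto)
      qed
    qed
  next
    fix x assume x: "x \<in> X"
    have "real (card (?A `` {x})) = real q ^ 2 - 1"
      using N11[OF _ diag[OF x]] unfolding Int by simp
    moreover have "1 \<le> q^2" using q by simp
    ultimately have "real (card (?A `` {x})) = real (q^2 - 1)" by (simp add: of_nat_diff)
    then show "card (?A `` {x}) = q^2 - 1" by (simp only: of_nat_eq_iff)
    have "{z \<in> X. (x, z) \<in> R 3 \<and> (z, x) \<in> R 3} = R 3 `` {x}"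
      using sub[of 3] symD[of 3] by auto
    then have "real (card (R 3 `` {x})) = real (q - 1)"
      using N33[OF _ diag[OF x]] q by (simp add: of_nat_diff)
    then have "card (R 3 `` {x}) = q - 1" by (simp only: of_nat_eq_iff)
    moreover have "?S `` {x} = insert x (R 3 `` {x})" using x by auto
    moreover have "x \<notin> R 3 `` {x}" using disj[of 0 3] diag[OF x] by auto
    moreover have "finite (R 3 `` {x})" using finite_subset[OF sub[of 3]] fin by (simp add: finite_Image)
    ultimately show "card (?S `` {x}) = q" using q by simp
  next
    fix x y assume "(x, y) \<in> ?A"
    then have "real (card (?A `` {x} \<inter> ?A `` {y})) = real (q - 2)"
      using N11[of 1 x y] q unfolding Int by (simp add: of_nat_diff)
    then show "card (?A `` {x} \<inter> ?A `` {y}) = q - 2" by (simp only: of_nat_eq_iff)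
  next
    fix x y assume "(x, y) \<in> ?S" "x \<noteq> y"
    then have "(x, y) \<in> R 3" by auto
    then have "card (?A `` {x} \<inter> ?A `` {y}) = 0" using N11[of 3 x y] unfolding Int by simp
    moreover have "finite (?A `` {x} \<inter> ?A `` {y})"
      using finite_subset[OF sub[of 1]] fin by (simp add: finite_Image)
    ultimately show "?A `` {x} \<inter> ?A `` {y} = {}" by simp
  next
    fix x y assume xy: "x \<in> X" "y \<in> X" "(x, y) \<notin> ?S"
    have R12: "(x, y) \<in> R 1 \<or> (x, y) \<in> R 2"
    proof -
      obtain k where "k \<le> 3" "(x, y) \<in> R k" using total xy by blast
      then show ?thesis using xy R0 by (cases rule: le_3_cases) auto
    qed
    show "card (?A `` {x} \<inter> ?A `` {y}) = q" if "(x, y) \<notin> ?A"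
      using N11[of 2 x y] R12 that unfolding Int by simp
    show "\<exists>!z. (x, z) \<in> ?A \<and> (z, y) \<in> ?S"
    proof (cases "(x, y) \<in> ?A")
      case True
      then have "card {z \<in> X. (x, z) \<in> R 1 \<and> (z, y) \<in> R 3} = 0" using N13[of 1 x y] by simp
      then have "\<not> ((x, z) \<in> R 1 \<and> (z, y) \<in> R 3)" for z using fin sub[of 1] by auto
      then have "(x, z) \<in> ?A \<and> (z, y) \<in> ?S \<longleftrightarrow> z = y" for z using True xy by auto
      then show ?thesis by simp
    next
      case False
      then have "card {z \<in> X. (x, z) \<in> R 1 \<and> (z, y) \<in> R 3} = 1" using N13[of 2 x y] R12 by simp
      then obtain t where "{z \<in> X. (x, z) \<in> R 1 \<and> (z, y) \<in> R 3} = {t}" by (rule card_1_singletonE)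
      then have "z \<in> X \<and> (x, z) \<in> R 1 \<and> (z, y) \<in> R 3 \<longleftrightarrow> z = t" for z by auto
      then have "(x, z) \<in> ?A \<and> (z, y) \<in> ?S \<longleftrightarrow> z = t" for z using False sub[of 1] by auto
      then show ?thesis by simp
    qed
  qed
qed

context antipodal_cover
begin

abbreviation (input) Q :: real where "Q \<equiv> real q"

text \<open>
  Matrices in the span of the four relations are handled through their coefficient vectors, so that
  identities between matrices become identities between polynomials in \<open>q\<close>.
\<close>

definition R :: "nat \<Rightarrow> 'a rel" where
  "R i = [Id_on X, A, X \<times> X - A - S, S - Id] ! i"

definition mat :: "(nat \<Rightarrow> real) \<Rightarrow> 'a sqmat" where
  "mat c = lin_comb {..3} c (\<lambda>j. rel_mat (R j))"

text \<open>The coefficients of \<open>mat c\<close> times the adjacency matrix.\<close>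

definition times_A :: "(nat \<Rightarrow> real) \<Rightarrow> nat \<Rightarrow> real" where
  "times_A c k =
     [c 1 * (Q^2 - 1),
      c 0 + c 1 * (Q - 2) + c 2 * (Q^2 - Q),
      c 1 * Q + c 2 * (Q^2 - Q - 2) + c 3,
      c 2 * (Q^2 - 1)] ! k"

lemma R_simps: "R 0 = Id_on X" "R 1 = A" "R (Suc 0) = A" "R 2 = X \<times> X - A - S" "R 3 = S - Id"
  by (simp_all add: R_def)

lemma R_partition:
  shows "(\<Union>i\<le>3. R i) = X \<times> X"
    and "i \<le> 3 \<Longrightarrow> j \<le> 3 \<Longrightarrow> i \<noteq> j \<Longrightarrow> R i \<inter> R j = {}"
proof -
  have un: "(\<Union>i\<le>3. R i) = R 0 \<union> R 1 \<union> R 2 \<union> R 3"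
    by (auto simp: numeral_3_eq_3 numeral_2_eq_2 atMost_Suc)
  show "(\<Union>i\<le>3. R i) = X \<times> X"
    unfolding un R_simps using A_subset S_subset by auto
  assume "i \<le> 3" "j \<le> 3" "i \<noteq> j"
  then show "R i \<inter> R j = {}"
    using A_irrefl A_S_disjoint S_refl
    by (elim le_3_cases) (auto simp: R_simps)
qed

lemma mat_entry: "k \<le> 3 \<Longrightarrow> (x, y) \<in> R k \<Longrightarrow> mat c x y = c k"
  unfolding mat_def by (rule lin_comb_rel_mat_entry) (use R_partition(2) in auto)

lemma mat_outside: "(x, y) \<notin> X \<times> X \<Longrightarrow> mat c x y = 0"
  using R_partition(1) unfolding mat_def lin_comb_def by (intro sum.neutral) (auto simp: rel_mat_def)

lemma R_cases:
  assumes "x \<in> X" "y \<in> X"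
  obtains k where "k \<le> 3" "(x, y) \<in> R k"
  using R_partition(1) assms by blast

lemma mat_cong: "(\<And>k. k \<le> 3 \<Longrightarrow> c k = d k) \<Longrightarrow> mat c = mat d"
  unfolding mat_def by (rule lin_comb_cong) auto

lemma lin_comb_mat: "lin_comb J c (\<lambda>j. mat (d j)) = mat (\<lambda>k. \<Sum>j\<in>J. c j * d j k)"
  unfolding mat_def by (rule lin_comb_lin_comb)

lemma rel_mat_R: "i \<le> 3 \<Longrightarrow> rel_mat (R i) = mat (\<lambda>j. of_bool (j = i))"
  unfolding mat_def by (rule lin_comb_delta[symmetric]) auto

lemma sum_R_neighbours:
  assumes "x \<in> X" "y \<in> X"
  shows "(\<Sum>i\<le>3. real (card {z \<in> X. (x, z) \<in> R i \<and> (z, y) \<in> A})) = Q^2 - 1"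
proof -
  have fin: "finite {z \<in> X. (x, z) \<in> R i \<and> (z, y) \<in> A}" for i using finite_X by simp
  have "A `` {y} = (\<Union>i\<le>3. {z \<in> X. (x, z) \<in> R i \<and> (z, y) \<in> A})" (is "_ = ?U")
  proof (intro subset_antisym subsetI)
    fix z assume z: "z \<in> A `` {y}"
    then have "z \<in> X" using A_subset by auto
    then obtain i where "i \<le> 3" "(x, z) \<in> R i" using R_cases[OF assms(1)] by blast
    then show "z \<in> ?U" using z \<open>z \<in> X\<close> A_symD by blast
  qed (use A_symD in auto)
  then have "card (A `` {y}) = card ?U" by simp
  also have "\<dots> = (\<Sum>i\<le>3. card {z \<in> X. (x, z) \<in> R i \<and> (z, y) \<in> A})"
    by (rule card_UN_disjoint) (use fin R_partition(2) in auto)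
  finally have "real (card (A `` {y})) =
      (\<Sum>i\<le>3. real (card {z \<in> X. (x, z) \<in> R i \<and> (z, y) \<in> A}))" by simp
  moreover have "1 \<le> q^2" using q_squares by simp
  ultimately show ?thesis using degree[OF assms(2)] by (simp add: of_nat_diff)
qed

text \<open>
  The counts for \<open>R 2\<close> come last, since those of all four relations add up to the valency.
\<close>

lemma R_A_count:
  assumes k: "k \<le> 3" "(x, y) \<in> R k"
  shows "real (card {z \<in> X. (x, z) \<in> R 0 \<and> (z, y) \<in> A}) = [0, 1, 0, 0] ! k"
    and "real (card {z \<in> X. (x, z) \<in> R 1 \<and> (z, y) \<in> A}) = [Q^2 - 1, Q - 2, Q, 0] ! k"
    and "real (card {z \<in> X. (x, z) \<in> R 2 \<and> (z, y) \<in> A}) = [0, Q^2 - Q, Q^2 - Q - 2, Q^2 - 1] ! k"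
    and "real (card {z \<in> X. (x, z) \<in> R 3 \<and> (z, y) \<in> A}) = [0, 0, 1, 0] ! k"
proof -
  have xy: "x \<in> X" "y \<in> X" using R_partition(1) k by blast+
  have N0: "{z \<in> X. (x, z) \<in> R 0 \<and> (z, y) \<in> A} = (if (x, y) \<in> A then {x} else {})"
    using xy by (auto simp: R_simps)
  show 0: "real (card {z \<in> X. (x, z) \<in> R 0 \<and> (z, y) \<in> A}) = [0, 1, 0, 0] ! k"
    unfolding N0 using k(2) S_subset A_S_disjoint A_irrefl by (cases rule: le_3_cases[OF k(1)]) (auto simp: R_simps)
  have N1: "{z \<in> X. (x, z) \<in> R 1 \<and> (z, y) \<in> A} = A `` {x} \<inter> A `` {y}"
    using A_subset A_symD by (auto simp: R_simps)
  have le: "1 \<le> q^2" using q_squares by simp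
  show 1: "real (card {z \<in> X. (x, z) \<in> R 1 \<and> (z, y) \<in> A}) = [Q^2 - 1, Q - 2, Q, 0] ! k"
    unfolding N1 using k(2) degree[OF xy(1)] adjacent_common[of x y] distance_2_common[OF xy]
      fibre_common[of x y] q_ge_2 le
    by (cases rule: le_3_cases[OF k(1)]) (auto simp: R_simps of_nat_diff)
  have N3: "card {z \<in> X. (x, z) \<in> R 3 \<and> (z, y) \<in> A} = of_bool ((x, y) \<in> R 2)"
  proof (cases "(x, y) \<in> R 2")
    case True
    then have xy': "(y, x) \<notin> S" "(x, y) \<notin> A" using S_symD by (auto simp: R_simps)
    obtain t where t: "(y, t) \<in> A" "(t, x) \<in> S" using matching[OF xy(2,1) xy'(1)] by blast
    have uniq: "z = t" if "(y, z) \<in> A" "(z, x) \<in> S" for z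
      using matching[OF xy(2,1) xy'(1)] t that by blast
    have "{z \<in> X. (x, z) \<in> R 3 \<and> (z, y) \<in> A} = {t}"
    proof (intro subset_antisym subsetI)
      fix z assume "z \<in> {z \<in> X. (x, z) \<in> R 3 \<and> (z, y) \<in> A}"
      then have "(y, z) \<in> A" "(z, x) \<in> S" using A_symD S_symD by (simp_all add: R_simps)
      then show "z \<in> {t}" using uniq by simp
    next
      fix z assume z: "z \<in> {t}"
      have "x \<noteq> t" using t(1) xy'(2) A_symD by blast
      then show "z \<in> {z \<in> X. (x, z) \<in> R 3 \<and> (z, y) \<in> A}"
        using z t A_symD S_symD A_subset by (auto simp: R_simps)
    qed
    then show ?thesis using True by simp
  next
    case False
    have "\<not> ((x, z) \<in> R 3 \<and> (z, y) \<in> A)" for z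
    proof
      assume "(x, z) \<in> R 3 \<and> (z, y) \<in> A"
      then have z: "(x, z) \<in> S" "x \<noteq> z" "(z, y) \<in> A" by (auto simp: R_simps)
      have "(x, y) \<notin> S" using S_trans[OF S_symD[OF z(1)], of y] z(3) A_S_disjoint by blast
      moreover have "(x, y) \<notin> A" using fibre_common[OF z(1,2)] z(3) A_symD by blast
      ultimately show False using False xy by (simp add: R_simps)
    qed
    then have none: "{z \<in> X. (x, z) \<in> R 3 \<and> (z, y) \<in> A} = {}" by blast
    show ?thesis unfolding none using False by simp
  qed
  have "(x, y) \<in> R 2 \<longleftrightarrow> k = 2" using k R_partition(2)[of k 2] by auto
  then show 3: "real (card {z \<in> X. (x, z) \<in> R 3 \<and> (z, y) \<in> A}) = [0, 0, 1, 0] ! k"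
    unfolding N3 by (cases rule: le_3_cases[OF k(1)]) auto
  show "real (card {z \<in> X. (x, z) \<in> R 2 \<and> (z, y) \<in> A}) = [0, Q^2 - Q, Q^2 - Q - 2, Q^2 - 1] ! k"
    using sum_R_neighbours[OF xy] unfolding sum_upto_3 0 1 3
    by (cases rule: le_3_cases[OF k(1)]) auto
qed

lemma mat_times_A: "mat_mult X (mat c) (rel_mat A) = mat (times_A c)"
proof (intro ext)
  fix x y
  have prod: "mat_mult X (mat c) (rel_mat A) x y =
      (\<Sum>i\<le>3. c i * real (card {z \<in> X. (x, z) \<in> R i \<and> (z, y) \<in> A}))"
    unfolding mat_def mat_mult_lin_comb_left by (simp add: lin_comb_def mat_mult_rel_mat[OF finite_X])
  show "mat_mult X (mat c) (rel_mat A) x y = mat (times_A c) x y"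
  proof (cases "(x, y) \<in> X \<times> X")
    case True
    then obtain k where k: "k \<le> 3" "(x, y) \<in> R k" using R_cases by blast
    show ?thesis
      unfolding prod mat_entry[OF k] sum_upto_3 R_A_count[OF k]
      by (rule le_3_cases[OF k(1)]) (simp_all add: times_A_def)
  next
    case False
    have R: "R i \<subseteq> X \<times> X" if "i \<le> 3" for i using R_partition(1) that by blast
    have "{z \<in> X. (x, z) \<in> R i \<and> (z, y) \<in> A} = {}" if "i \<le> 3" for i
      using False R[OF that] A_subset by auto
    then have "c i * real (card {z \<in> X. (x, z) \<in> R i \<and> (z, y) \<in> A}) = 0" if "i \<le> 3" for i
      using that by (simp only: card.empty)
    then show ?thesis unfolding prod mat_outside[OF False] by (intro sum.neutral ballI) auto
  qed
qed

lemma mat_pow_A: "mat_pow X (rel_mat A) n = mat ((times_A ^^ n) (\<lambda>j. of_bool (j = 0)))"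
proof (induction n)
  case 0
  then show ?case using rel_mat_R[of 0] by (simp add: R_simps)
next
  case (Suc n)
  then show ?case by (simp add: mat_times_A)
qed

lemma mat_times_pow_A:
  "mat_mult X (mat c) (mat_pow X (rel_mat A) n) = mat ((times_A ^^ n) c)"
proof (induction n)
  case 0
  have "mat_mult X (mat c) (rel_mat (Id_on X)) x y = mat c x y" for x y
  proof -
    have "mat_mult X (mat c) (rel_mat (Id_on X)) x y = (\<Sum>z\<in>X. if z = y then mat c x z else 0)"
      unfolding mat_mult_def by (rule sum.cong) (auto simp: rel_mat_def)
    also have "\<dots> = mat c x y" using finite_X mat_outside[of x y] by auto
    finally show ?thesis .
  qed
  then show ?case by (simp add: fun_eq_iff)
next
  case (Suc n)
  have "mat_mult X (mat c) (mat_pow X (rel_mat A) (Suc n)) =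
      mat_mult X (mat_mult X (mat c) (mat_pow X (rel_mat A) n)) (rel_mat A)"
    by (simp add: mat_mult_assoc)
  then show ?case by (simp add: Suc.IH mat_times_A)
qed

text \<open>
  The first four powers of the adjacency matrix are triangular in the basis \<open>R\<close>, with nonzero
  diagonal; the coefficients arise by back substitution.
\<close>

lemma mat_is_polynomial: "\<exists>c. mat d = lin_comb {..<4} c (mat_pow X (rel_mat A))"
proof -
  define c3 where "c3 = d 3 / (Q * (Q^2 - 1))"
  define c2 where "c2 = (d 2 - c3 * ((Q - 2) * Q + Q * (Q^2 - Q - 2))) / Q"
  define c1 where "c1 = d 1 - c2 * (Q - 2) - c3 * (Q^2 - 1 + (Q - 2)^2 + Q * (Q^2 - Q))"
  define c0 where "c0 = d 0 - c2 * (Q^2 - 1) - c3 * ((Q - 2) * (Q^2 - 1))"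
  have Q: "Q \<noteq> 0" using q_ge_2 by simp
  have "1 < Q^2" using q_squares(2) by (metis of_nat_1 of_nat_less_iff of_nat_power)
  then have Q1: "Q^2 - 1 \<noteq> 0" by simp
  have e3: "c3 * (Q * (Q^2 - 1)) = d 3" using Q Q1 by (simp add: c3_def)
  have e2: "c2 * Q = d 2 - c3 * ((Q - 2) * Q + Q * (Q^2 - Q - 2))" using Q by (simp add: c2_def)
  have sum4: "(\<Sum>n<4. f n) = f 0 + f 1 + f 2 + f 3" for f :: "nat \<Rightarrow> real"
    by (simp add: numeral_eq_Suc)
  have "mat d = mat (\<lambda>k. \<Sum>n<4. [c0, c1, c2, c3] ! n * (times_A ^^ n) (\<lambda>j. of_bool (j = 0)) k)"
  proof (rule mat_cong)
    fix k :: nat assume "k \<le> 3"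
    then show "d k = (\<Sum>n<4. [c0, c1, c2, c3] ! n * (times_A ^^ n) (\<lambda>j. of_bool (j = 0)) k)"
    proof (cases rule: le_3_cases)
      case 1
      then show ?thesis
        by (simp add: sum4 times_A_def numeral_eq_Suc c0_def algebra_simps)
    next
      case 2
      then show ?thesis
        by (simp add: sum4 times_A_def numeral_eq_Suc c1_def algebra_simps)
    next
      case 3
      then show ?thesis using e2
        by (simp add: sum4 times_A_def numeral_eq_Suc algebra_simps)
    next
      case 4
      then show ?thesis using e3
        by (simp add: sum4 times_A_def numeral_eq_Suc algebra_simps)
    qed
  qed
  then show ?thesis unfolding lin_comb_mat[symmetric] mat_pow_A[symmetric] by blast
qed

lemma mat_times_mat: "\<exists>c. mat_mult X (mat a) (mat b) = mat c"
proof -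
  obtain c where c: "mat b = lin_comb {..<4} c (mat_pow X (rel_mat A))"
    using mat_is_polynomial by blast
  show ?thesis unfolding c mat_mult_lin_comb_right mat_times_pow_A lin_comb_mat by blast
qed

text \<open>
  The span of the relations consists of the polynomials in the adjacency matrix, hence is closed under
  products. The entries of a product of relations are then constant on each relation.
\<close>

lemma assoc_scheme_R: "assoc_scheme X 3 R"
proof -
  obtain c where c: "\<And>a b. mat_mult X (mat a) (mat b) = mat (c a b)"
    using mat_times_mat by metis
  \<comment> \<open>The coefficient is a cardinality whenever \<open>R k\<close> contains a pair, and then rounding recovers it.\<close>
  define p where "p i j k = nat \<lfloor>c (\<lambda>l. of_bool (l = i)) (\<lambda>l. of_bool (l = j)) k\<rfloor>" for i j k
  have p: "card {z \<in> X. (x, z) \<in> R i \<and> (z, y) \<in> R j} = p i j k"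
    if ij: "i \<le> 3" "j \<le> 3" and k: "k \<le> 3" "(x, y) \<in> R k" for i j k x y
  proof -
    have "real (card {z \<in> X. (x, z) \<in> R i \<and> (z, y) \<in> R j}) =
        c (\<lambda>l. of_bool (l = i)) (\<lambda>l. of_bool (l = j)) k"
      unfolding mat_mult_rel_mat[OF finite_X, symmetric] rel_mat_R[OF ij(1)] rel_mat_R[OF ij(2)] c
        mat_entry[OF k] ..
    from arg_cong[OF this, of floor] show ?thesis by (simp add: p_def)
  qed
  have sym: "sym (R i)" if "i \<le> 3" for i
    using that A_symD S_symD by (elim le_3_cases) (auto simp: R_simps sym_def)
  obtain x where x: "x \<in> X" using X_nonempty by blast
  have "\<not> S `` {x} \<subseteq> {x}" using card_fibre[OF x] q_ge_2 card_mono[of "{x}" "S `` {x}"] by auto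
  then have R3: "R 3 \<noteq> {}" by (auto simp: R_simps)
  have "A `` {x} \<noteq> {}" using degree[OF x] q_squares by auto
  then have R1: "R 1 \<noteq> {}" by (auto simp: R_simps)
  have R2: "R 2 \<noteq> {}"
  proof
    assume R2: "R 2 = {}"
    obtain y where y: "(x, y) \<in> R 3" using \<open>\<not> S `` {x} \<subseteq> {x}\<close> by (auto simp: R_simps)
    have "Q^2 - 1 = 0" using R_A_count(3)[OF _ y] by (simp add: R2)
    moreover have "1 < Q^2" using q_squares(2) by (metis of_nat_1 of_nat_less_iff of_nat_power)
    ultimately show False by simp
  qed
  have "R i \<noteq> {}" if "i \<le> 3" for i
    using that x R1 R2 R3 by (elim le_3_cases) (auto simp: R_simps(1))
  moreover have "\<forall>i\<le>3. \<forall>j\<le>3. \<forall>k\<le>3. \<forall>(x, y)\<in>R k.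
      card {z \<in> X. (x, z) \<in> R i \<and> (z, y) \<in> R j} = p i j k"
    using p by auto
  ultimately show ?thesis
    unfolding assoc_scheme_def using finite_X R_simps(1) R_partition sym by (intro conjI exI[of _ p]) auto
qed

lemma generates_scheme_R: "generates_scheme (rel_mat A) X 3 R"
  unfolding generates_scheme_def
proof (intro conjI assoc_scheme_R subset_antisym subsetI)
  have BM: "bose_mesner 3 R = range mat" by (auto simp: bose_mesner_def mat_def)
  fix M
  show "M \<in> {lin_comb {..<n} c (mat_pow X (rel_mat A)) |c n. True}" if "M \<in> bose_mesner 3 R"
    using that mat_is_polynomial unfolding BM by blast
  show "M \<in> bose_mesner 3 R" if "M \<in> {lin_comb {..<n} c (mat_pow X (rel_mat A)) |c n. True}"
    using that unfolding BM mat_pow_A lin_comb_mat by blast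
qed

text \<open>The eigenvalue of \<open>mat c\<close> on the \<open>i\<close>-th eigenspace.\<close>

definition eigenvalue :: "nat \<Rightarrow> (nat \<Rightarrow> real) \<Rightarrow> real" where
  "eigenvalue i c = (\<Sum>k\<le>3. c k * regular_point_matrix Q i k)"

text \<open>
  The coefficients of the \<open>i\<close>-th idempotent are \<open>m\<^sub>i P\<^sub>i\<^sub>j / (n k\<^sub>j)\<close>, where \<open>m\<^sub>i\<close> is the multiplicity,
  \<open>k\<^sub>j\<close> the valency and \<open>n = q\<^sup>3\<close>. Scaled by \<open>2n\<close> they are polynomials in \<open>q\<close>.
\<close>

definition scaled_idem :: "nat \<Rightarrow> nat \<Rightarrow> real" where
  "scaled_idem i j =
     [[2, 2, 2, 2],
      [Q * (Q^2 - 1), Q * (Q - 1), - Q, - Q * (Q + 1)],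
      [2 * (Q^2 - 1), - 2, - 2, 2 * (Q^2 - 1)],
      [Q * (Q - 1)^2, - Q * (Q - 1), Q, - Q * (Q - 1)]] ! i ! j"

definition idem :: "nat \<Rightarrow> nat \<Rightarrow> real" where
  "idem i j = inverse (2 * Q^3) * scaled_idem i j"

text \<open>
  Multiplicativity in one factor is enough, since the span consists of the polynomials in the adjacency
  matrix.
\<close>

lemma eigenvalue_times_A:
  assumes "i \<le> 3"
  shows "eigenvalue i (times_A c) = regular_point_matrix Q i 1 * eigenvalue i c"
  by (rule le_3_cases[OF assms])
    (simp_all add: eigenvalue_def sum_upto_3 times_A_def regular_point_matrix_def
      power2_eq_square algebra_simps)

lemma Q_factors: "Q \<noteq> 0" "Q - 1 \<noteq> 0" "Q + 1 \<noteq> 0"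
  using q_ge_2 by auto

lemma times_A_scale: "k \<le> 3 \<Longrightarrow> times_A (\<lambda>l. a * c l) k = a * times_A c k"
  by (elim le_3_cases) (simp_all add: times_A_def algebra_simps)

lemma times_A_scaled_idem:
  assumes "i \<le> 3" "k \<le> 3"
  shows "times_A (scaled_idem i) k = regular_point_matrix Q i 1 * scaled_idem i k"
  by (rule le_3_cases[OF assms(1)]; rule le_3_cases[OF assms(2)];
      simp add: times_A_def scaled_idem_def regular_point_matrix_def power2_eq_square algebra_simps)

lemma times_A_idem:
  assumes "i \<le> 3" "k \<le> 3"
  shows "times_A (idem i) k = regular_point_matrix Q i 1 * idem i k"
proof -
  have "times_A (idem i) k = inverse (2 * Q^3) * times_A (scaled_idem i) k"
    unfolding times_A_scale[OF assms(2), symmetric] by (simp add: idem_def[abs_def])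
  then show ?thesis by (simp add: times_A_scaled_idem[OF assms] idem_def mult_ac del: One_nat_def)
qed

lemma eigenvalue_scaled_idem:
  assumes "i \<le> 3" "j \<le> 3"
  shows "eigenvalue i (scaled_idem j) = 2 * Q^3 * of_bool (i = j)"
  by (rule le_3_cases[OF assms(1)]; rule le_3_cases[OF assms(2)];
      simp add: eigenvalue_def sum_upto_3 scaled_idem_def regular_point_matrix_def
        power2_eq_square power3_eq_cube algebra_simps)

lemma eigenvalue_idem:
  assumes "i \<le> 3" "j \<le> 3"
  shows "eigenvalue i (idem j) = of_bool (i = j)"
proof -
  have "eigenvalue i (idem j) = inverse (2 * Q^3) * eigenvalue i (scaled_idem j)"
    by (simp add: eigenvalue_def idem_def sum_distrib_left mult.assoc)
  then show ?thesis using Q_factors(1) by (simp add: eigenvalue_scaled_idem[OF assms])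
qed

lemma sum_scaled_idem:
  assumes "j \<le> 3" "k \<le> 3"
  shows "(\<Sum>i\<le>3. regular_point_matrix Q i j * scaled_idem i k) = 2 * Q^3 * of_bool (k = j)"
  by (rule le_3_cases[OF assms(1)]; rule le_3_cases[OF assms(2)];
      simp add: sum_upto_3 scaled_idem_def regular_point_matrix_def
        power2_eq_square power3_eq_cube algebra_simps)

lemma sum_idem:
  assumes "j \<le> 3" "k \<le> 3"
  shows "(\<Sum>i\<le>3. regular_point_matrix Q i j * idem i k) = of_bool (k = j)"
proof -
  have "(\<Sum>i\<le>3. regular_point_matrix Q i j * idem i k) =
      inverse (2 * Q^3) * (\<Sum>i\<le>3. regular_point_matrix Q i j * scaled_idem i k)"
    by (simp add: idem_def sum_distrib_left mult_ac)
  then show ?thesis using Q_factors(1) by (simp add: sum_scaled_idem[OF assms])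
qed

lemma eigenvalue_pow_A:
  assumes "i \<le> 3"
  shows "eigenvalue i ((times_A ^^ n) c) = regular_point_matrix Q i 1 ^ n * eigenvalue i c"
  by (induction n) (simp_all add: eigenvalue_times_A[OF assms] del: One_nat_def)

lemma pow_A_idem:
  assumes "i \<le> 3"
  shows "mat_mult X (mat (idem i)) (mat_pow X (rel_mat A) n) =
    mat (\<lambda>k. regular_point_matrix Q i 1 ^ n * idem i k)"
proof (induction n)
  case 0
  show ?case using mat_times_pow_A[of "idem i" 0] by simp
next
  case (Suc n)
  let ?t = "regular_point_matrix Q i 1"
  have "mat_mult X (mat (idem i)) (mat_pow X (rel_mat A) (Suc n)) =
      mat_mult X (mat (\<lambda>k. ?t ^ n * idem i k)) (rel_mat A)"
    unfolding mat_pow.simps mat_mult_assoc[symmetric] Suc.IH ..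
  also have "\<dots> = mat (times_A (\<lambda>k. ?t ^ n * idem i k))" by (rule mat_times_A)
  also have "\<dots> = mat (\<lambda>k. ?t ^ n * times_A (idem i) k)"
    by (rule mat_cong, erule le_3_cases) (simp_all add: times_A_def algebra_simps)
  also have "\<dots> = mat (\<lambda>k. ?t ^ Suc n * idem i k)"
    by (rule mat_cong) (simp add: times_A_idem[OF assms] mult_ac)
  finally show ?case .
qed

text \<open>
  The adjacency matrix acts on the \<open>i\<close>-th idempotent as a scalar; every matrix in the span is a
  polynomial in it and so acts as a scalar too.
\<close>

lemma idem_times_mat:
  assumes i: "i \<le> 3"
  shows "mat_mult X (mat (idem i)) (mat d) = mat (\<lambda>k. eigenvalue i d * idem i k)"
proof -
  let ?t = "regular_point_matrix Q i 1" and ?one = "\<lambda>j::nat. of_bool (j = 0) :: real"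
  obtain c where c: "mat d = lin_comb {..<4} c (mat_pow X (rel_mat A))"
    using mat_is_polynomial by blast
  have mat_d: "mat d = mat (\<lambda>k. \<Sum>n<4. c n * (times_A ^^ n) ?one k)"
    unfolding c mat_pow_A lin_comb_mat ..
  have d: "d k = (\<Sum>n<4. c n * (times_A ^^ n) ?one k)" if k: "k \<le> 3" for k
  proof -
    have "R k \<noteq> {}" using assoc_scheme_R k by (simp add: assoc_scheme_def)
    then obtain x y where xy: "(x, y) \<in> R k" by auto
    show ?thesis using fun_cong[OF fun_cong[OF mat_d, of x], of y] unfolding mat_entry[OF k xy] .
  qed
  have one: "eigenvalue i ?one = 1"
    using i by (elim le_3_cases) (simp_all add: eigenvalue_def sum_upto_3 regular_point_matrix_def)
  have "eigenvalue i d = eigenvalue i (\<lambda>k. \<Sum>n<4. c n * (times_A ^^ n) ?one k)"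
    by (simp add: eigenvalue_def d)
  also have "\<dots> = (\<Sum>k\<le>3. \<Sum>n<4. c n * ((times_A ^^ n) ?one k * regular_point_matrix Q i k))"
    by (simp add: eigenvalue_def sum_distrib_right mult.assoc)
  also have "\<dots> = (\<Sum>n<4. c n * eigenvalue i ((times_A ^^ n) ?one))"
    unfolding eigenvalue_def sum_distrib_left by (rule sum.swap)
  also have "\<dots> = (\<Sum>n<4. c n * ?t ^ n)"
    by (simp add: eigenvalue_pow_A[OF i] one del: One_nat_def)
  finally have ev: "eigenvalue i d = (\<Sum>n<4. c n * ?t ^ n)" .
  show ?thesis
    unfolding c mat_mult_lin_comb_right pow_A_idem[OF i] lin_comb_mat ev
    by (simp add: sum_distrib_right mult.assoc)
qed

lemma first_eigenmatrix_R: "first_eigenmatrix X 3 R (regular_point_matrix Q)"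
  unfolding first_eigenmatrix_def
proof (intro exI conjI allI impI)
  let ?E = "\<lambda>i. mat (idem i)"
  have decomp: "lin_comb {..3} (\<lambda>i. regular_point_matrix Q i j) ?E = rel_mat (R j)" if "j \<le> 3" for j
    unfolding lin_comb_mat rel_mat_R[OF that] by (rule mat_cong) (rule sum_idem[OF that])
  show "rel_mat (R j) = lin_comb {..3} (\<lambda>i. regular_point_matrix Q i j) ?E" if "j \<le> 3" for j
    using decomp[OF that] ..
  show "primitive_idempotents X 3 R ?E"
    unfolding primitive_idempotents_def
  proof (intro conjI allI impI)
    fix i :: nat assume i: "i \<le> 3"
    show "?E i \<in> bose_mesner 3 R" by (auto simp: bose_mesner_def mat_def)
    obtain x where "x \<in> X" using X_nonempty by blast
    then have diag: "?E i x x = idem i 0" by (intro mat_entry) (auto simp: R_simps)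
    have "Q^2 - 1 \<noteq> 0" using q_ge_2 by (simp add: power2_eq_square flip: of_nat_mult)
    then have "idem i 0 \<noteq> 0"
      by (rule_tac le_3_cases[OF i]) (use Q_factors in \<open>simp_all add: idem_def scaled_idem_def\<close>)
    then show "?E i \<noteq> (\<lambda>x y. 0)" using diag by auto
    show "mat_mult X (?E i) (?E j) = (if i = j then ?E i else (\<lambda>x y. 0))" if j: "j \<le> 3" for j
      unfolding idem_times_mat[OF i] eigenvalue_idem[OF i j] by (simp add: mat_def lin_comb_def)
  next
    have "lin_comb {..3} (\<lambda>i. regular_point_matrix Q i 0) ?E = lin_comb {..3} (\<lambda>_. 1) ?E"
      by (rule lin_comb_cong) (auto elim!: le_3_cases simp: regular_point_matrix_def)
    then show "lin_comb {..3} (\<lambda>_. 1) ?E = rel_mat (Id_on X)"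
      using decomp[of 0] by (simp add: R_simps)
  qed
qed

end

section \<open>The graph of a cover and a plane is strongly regular\<close>

text \<open>
  All neighbourhoods in the graph have this shape. Common neighbours are thereby counted separately
  among the apex, the lines and the vertices of the cover.
\<close>

definition mixed :: "bool \<Rightarrow> 'l set \<Rightarrow> 'h set \<Rightarrow> ('l, 'h) cover_vertex set" where
  "mixed b L U = (if b then {Apex} else {}) \<union> Line ` L \<union> Vert ` U"

lemma mixed_iff [simp]:
  "Apex \<in> mixed b L U \<longleftrightarrow> b" "Line l \<in> mixed b L U \<longleftrightarrow> l \<in> L" "Vert x \<in> mixed b L U \<longleftrightarrow> x \<in> U"
  by (auto simp: mixed_def)

lemma mixed_eqI:
  assumes "Apex \<in> Z \<longleftrightarrow> b" "\<And>l. Line l \<in> Z \<longleftrightarrow> l \<in> L" "\<And>x. Vert x \<in> Z \<longleftrightarrow> x \<in> U"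
  shows "Z = mixed b L U"
proof (rule set_eqI)
  fix z show "z \<in> Z \<longleftrightarrow> z \<in> mixed b L U" using assms by (cases z) simp_all
qed

lemma mixed_Int: "mixed b L U \<inter> mixed b' L' U' = mixed (b \<and> b') (L \<inter> L') (U \<inter> U')"
  by (rule mixed_eqI) auto

lemma card_mixed:
  fixes L :: "'l set" and U :: "'h set"
  assumes "finite L" "finite U"
  shows "card (mixed b L U) = of_bool b + card L + card U"
proof -
  let ?B = "(if b then {Apex} else {}) :: ('l, 'h) cover_vertex set"
  have "card (mixed b L U) = card (?B \<union> Line ` L) + card (Vert ` U :: ('l, 'h) cover_vertex set)"
    unfolding mixed_def using assms by (intro card_Un_disjoint) auto
  also have "card (?B \<union> Line ` L) = card ?B + card (Line ` L :: ('l, 'h) cover_vertex set)"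
    using assms by (intro card_Un_disjoint) auto
  finally show ?thesis by (simp add: card_image inj_on_def)
qed

locale cover_with_plane =
  antipodal_cover q "pverts H" "parcs H" "antipodal_rel H" + plane_design q I
  for q :: nat and H :: "'h pair_pre_digraph" and I :: "('p, 'l) incidence_structure" +
  fixes \<phi> :: "'h set \<Rightarrow> 'p"
  assumes bij: "bij_betw \<phi> (fibres H) (points I)"
begin

abbreviation "G \<equiv> cover_plane_graph H I \<phi>"

definition point :: "'h \<Rightarrow> 'p" where
  "point x = \<phi> (antipodal_rel H `` {x})"

lemma fibres_eq: "fibres H = (\<lambda>x. antipodal_rel H `` {x}) ` pverts H"
  by (auto simp: fibres_def quotient_def)

lemma point_eq_iff:
  assumes "x \<in> pverts H" "y \<in> pverts H"
  shows "point x = point y \<longleftrightarrow> (x, y) \<in> antipodal_rel H"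
proof -
  have "point x = point y \<longleftrightarrow> antipodal_rel H `` {x} = antipodal_rel H `` {y}"
    using assms bij unfolding point_def by (intro inj_on_eq_iff[of \<phi> "fibres H"])
      (auto simp: bij_betw_def fibres_eq)
  then show ?thesis using eq_equiv_class_iff[OF equiv_S assms] by simp
qed

lemma point_image: "point ` pverts H = points I"
  using bij by (auto simp: bij_betw_def fibres_eq point_def image_image)

lemma point_in_points: "x \<in> pverts H \<Longrightarrow> point x \<in> points I"
  using point_image by blast

text \<open>The only fibre containing \<open>x\<close> is its class.\<close>

lemma flag_iff:
  "(\<exists>W\<in>fibres H. x \<in> W \<and> inc I (\<phi> W) l) \<longleftrightarrow> x \<in> pverts H \<and> inc I (point x) l"
proof -
  have "x \<in> W \<and> W \<in> fibres H \<longleftrightarrow> x \<in> pverts H \<and> W = antipodal_rel H `` {x}" for W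
  proof
    assume W: "x \<in> W \<and> W \<in> fibres H"
    then obtain y where y: "y \<in> pverts H" "W = antipodal_rel H `` {y}" by (auto simp: fibres_eq)
    then have yx: "(y, x) \<in> antipodal_rel H" using W by simp
    then have "x \<in> pverts H" using S_subset by auto
    then show "x \<in> pverts H \<and> W = antipodal_rel H `` {x}"
      using equiv_class_eq[OF equiv_S yx] y(2) by simp
  next
    assume x: "x \<in> pverts H \<and> W = antipodal_rel H `` {x}"
    then show "x \<in> W \<and> W \<in> fibres H" using S_refl[of x] unfolding fibres_eq by blast
  qed
  then have "(\<exists>W\<in>fibres H. x \<in> W \<and> inc I (\<phi> W) l) \<longleftrightarrow>
      (\<exists>W. x \<in> pverts H \<and> W = antipodal_rel H `` {x} \<and> inc I (\<phi> W) l)"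
    by (metis (lifting))
  then show ?thesis by (simp add: point_def)
qed

lemma arcs_G:
  "(Apex, Apex) \<notin> parcs G"
  "(Apex, Line l) \<in> parcs G \<longleftrightarrow> l \<in> lines I"
  "(Line l, Apex) \<in> parcs G \<longleftrightarrow> l \<in> lines I"
  "(Apex, Vert x) \<notin> parcs G"
  "(Vert x, Apex) \<notin> parcs G"
  "(Line l, Line m) \<in> parcs G \<longleftrightarrow> l \<in> lines I \<and> m \<in> lines I \<and> l \<noteq> m \<and> parallel I l m"
  "(Line l, Vert x) \<in> parcs G \<longleftrightarrow> l \<in> lines I \<and> x \<in> pverts H \<and> inc I (point x) l"
  "(Vert x, Line l) \<in> parcs G \<longleftrightarrow> l \<in> lines I \<and> x \<in> pverts H \<and> inc I (point x) l"
  "(Vert x, Vert y) \<in> parcs G \<longleftrightarrow> (x, y) \<in> parcs H"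
  unfolding cover_plane_graph_def Let_def flag_iff by auto

lemma verts_G: "pverts G = mixed True (lines I) (pverts H)"
  by (auto simp: cover_plane_graph_def mixed_def)

definition flags :: "'l \<Rightarrow> 'h set" where
  "flags l = {x \<in> pverts H. inc I (point x) l}"

definition pencil :: "'h \<Rightarrow> 'l set" where
  "pencil x = {l \<in> lines I. inc I (point x) l}"

lemma neighbours:
  "parcs G `` {Apex} = mixed False (lines I) {}"
  "l \<in> lines I \<Longrightarrow> parcs G `` {Line l} = mixed True (parallels l - {l}) (flags l)"
  "x \<in> pverts H \<Longrightarrow> parcs G `` {Vert x} = mixed False (pencil x) (parcs H `` {x})"
  by (rule mixed_eqI; auto simp: arcs_G flags_def pencil_def)+

lemma finite_parts:
  "finite (flags l)" "finite (pencil x)" "finite (parallels l)" "finite (parcs H `` {x})"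
  using finite_X finite_lines finite_A_Image by (auto simp: flags_def pencil_def)

lemma flags_eq: "flags l = {x \<in> pverts H. point x \<in> pts l}"
  using point_in_points by (auto simp: flags_def)

lemma card_flags: "l \<in> lines I \<Longrightarrow> card (flags l) = q * q"
  unfolding flags_eq using card_over_points[OF point_eq_iff, of "pts l"]
  by (auto simp: card_line point_image)

lemma card_pencil_H: "x \<in> pverts H \<Longrightarrow> card (pencil x) = q + 1"
  unfolding pencil_def by (rule card_pencil[OF point_in_points])

text \<open>
  The neighbours of \<open>x\<close> lie over the points other than \<open>point x\<close>, one over each.
\<close>

lemma card_flags_Int_neighbours:
  assumes "l \<in> lines I" "x \<in> pverts H"
  shows "card (flags l \<inter> parcs H `` {x}) = (if inc I (point x) l then q - 1 else q)"
proof -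
  have "flags l \<inter> parcs H `` {x} = {y \<in> parcs H `` {x}. point y \<in> pts l}"
    unfolding flags_eq using A_subset by auto
  then have "card (flags l \<inter> parcs H `` {x}) = card (pts l - {point x})"
    using card_neighbours_over_points[OF point_eq_iff, of "pts l" x] assms point_image by auto
  then show ?thesis
    using card_line[OF assms(1)] finite_points point_in_points[OF assms(2)]
    by (auto simp: card_Diff_singleton_if)
qed

lemma card_pencil_Int:
  assumes x: "x \<in> pverts H" and y: "y \<in> pverts H" and xy: "(x, y) \<notin> antipodal_rel H"
  shows "card (pencil x \<inter> pencil y) = 1"
proof -
  have "point x \<noteq> point y" using point_eq_iff[OF x y] xy by simp
  note unique = unique_line[OF point_in_points[OF x] point_in_points[OF y] this]
  have Int: "pencil x \<inter> pencil y = {l. l \<in> lines I \<and> inc I (point x) l \<and> inc I (point y) l}"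
    unfolding pencil_def by blast
  show ?thesis unfolding Int card_eq_1_iff_unique by (rule unique)
qed

lemma parallels_eq:
  assumes "l \<in> lines I" "m \<in> lines I" "parallel I l m"
  shows "parallels l = parallels m"
  using parallel_trans parallel_sym assms by blast

text \<open>
  Parallel lines have the apex and the other \<open>q - 2\<close> lines of their class in common; two intersecting
  lines have the apex and the fibre over their point of intersection.
\<close>

lemma common_line_line:
  assumes l: "l \<in> lines I" and m: "m \<in> lines I" and lm: "l \<noteq> m"
  shows "card (parcs G `` {Line l} \<inter> parcs G `` {Line m}) =
    (if parallel I l m then q - 1 else q + 1)"
proof -
  have card: "card (parcs G `` {Line l} \<inter> parcs G `` {Line m}) =
      1 + card ((parallels l - {l}) \<inter> (parallels m - {m})) + card (flags l \<inter> flags m)"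
    unfolding neighbours(2)[OF l] neighbours(2)[OF m] mixed_Int
    by (subst card_mixed) (auto simp: finite_parts)
  show ?thesis
  proof (cases "parallel I l m")
    case True
    have "(parallels l - {l}) \<inter> (parallels m - {m}) = parallels l - {l, m}"
      using parallels_eq[OF l m True] by blast
    moreover have "{l, m} \<subseteq> parallels l" using l m True by (auto simp: parallel_def)
    ultimately have "card ((parallels l - {l}) \<inter> (parallels m - {m})) = q - 2"
      using card_parallels[OF l] lm by (simp add: card_Diff_subset)
    moreover have "flags l \<inter> flags m = {}"
      using True lm point_in_points by (auto simp: parallel_def flags_def)
    ultimately show ?thesis using True card order_ge_2 by simp
  next
    case False
    then obtain t where t: "t \<in> points I" "inc I t l" "inc I t m" by (auto simp: parallel_def)
    have no_third: "(parallels l - {l}) \<inter> (parallels m - {m}) = {}"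
    proof -
      have "parallel I l m" if "n \<in> lines I" "parallel I l n" "parallel I m n" for n
        using parallel_trans[OF l that(1) m that(2)] parallel_sym[OF that(3)] by blast
      then show ?thesis using False by blast
    qed
    have "flags l \<inter> flags m = {x \<in> pverts H. point x = t}"
    proof (intro subset_antisym subsetI)
      fix x assume "x \<in> flags l \<inter> flags m"
      then show "x \<in> {x \<in> pverts H. point x = t}"
        using meet_at_most_once[OF l m lm, of t "point x"] t point_in_points by (auto simp: flags_def)
    qed (use t in \<open>auto simp: flags_def\<close>)
    then have "card (flags l \<inter> flags m) = q"
      using card_fibre_of_point[OF point_eq_iff, of t] t(1) point_image by simp
    then show ?thesis using False card by (simp add: no_third)
  qed
qed

text \<open>
  Through the point below \<open>x\<close> goes exactly one line parallel to \<open>l\<close>. If it is not \<open>l\<close> itself, it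
  is a common neighbour, and so is one neighbour of \<open>x\<close> over each of the \<open>q\<close> points of \<open>l\<close>; if it is
  \<open>l\<close>, only the \<open>q - 1\<close> other points of \<open>l\<close> contribute.
\<close>

lemma common_line_vert:
  assumes l: "l \<in> lines I" and x: "x \<in> pverts H"
  shows "card (parcs G `` {Line l} \<inter> parcs G `` {Vert x}) =
    (if inc I (point x) l then q - 1 else q + 1)"
proof -
  have card: "card (parcs G `` {Line l} \<inter> parcs G `` {Vert x}) =
      card ((parallels l - {l}) \<inter> pencil x) + card (flags l \<inter> parcs H `` {x})"
    unfolding neighbours(2)[OF l] neighbours(3)[OF x] mixed_Int
    by (subst card_mixed) (auto simp: finite_parts)
  show ?thesis
  proof (cases "inc I (point x) l")
    case True
    then have "(parallels l - {l}) \<inter> pencil x = {}"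
      using point_in_points[OF x] by (auto simp: parallel_def pencil_def)
    then show ?thesis using True card card_flags_Int_neighbours[OF l x] by simp
  next
    case False
    then have "(parallels l - {l}) \<inter> pencil x = {m \<in> parallels l. inc I (point x) m}"
      by (auto simp: pencil_def)
    then show ?thesis
      using False card card_flags_Int_neighbours[OF l x]
        card_parallels_through[OF l point_in_points[OF x]] by simp
  qed
qed

text \<open>
  In the cover, adjacent vertices have \<open>q - 2\<close>, vertices at distance two \<open>q\<close> and vertices of one
  fibre no common neighbours. The lines make up for the difference: one through two points, \<open>q + 1\<close>
  through a single one.
\<close>

lemma common_vert_vert:
  assumes x: "x \<in> pverts H" and y: "y \<in> pverts H" and xy: "x \<noteq> y"
  shows "card (parcs G `` {Vert x} \<inter> parcs G `` {Vert y}) =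
    (if (x, y) \<in> parcs H then q - 1 else q + 1)"
proof -
  have card: "card (parcs G `` {Vert x} \<inter> parcs G `` {Vert y}) =
      card (pencil x \<inter> pencil y) + card (parcs H `` {x} \<inter> parcs H `` {y})"
    unfolding neighbours(3)[OF x] neighbours(3)[OF y] mixed_Int
    by (subst card_mixed) (auto simp: finite_parts)
  show ?thesis
  proof (cases "(x, y) \<in> antipodal_rel H")
    case True
    then have "pencil x = pencil y" using point_eq_iff[OF x y] by (simp add: pencil_def)
    moreover have "(x, y) \<notin> parcs H" using True A_S_disjoint by blast
    ultimately show ?thesis using card card_pencil_H[OF y] fibre_common[OF True xy] by simp
  next
    case False
    then show ?thesis
      using card card_pencil_Int[OF x y False] adjacent_common[of x y]
        distance_2_common[OF x y _ False] order_ge_2 by auto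
  qed
qed

lemma common_apex_line:
  assumes "l \<in> lines I"
  shows "card (parcs G `` {Apex} \<inter> parcs G `` {Line l}) = q - 1"
proof -
  have "lines I \<inter> (parallels l - {l}) = parallels l - {l}" by auto
  moreover have "l \<in> parallels l" using assms by (simp add: parallel_def)
  ultimately show ?thesis
    unfolding neighbours(1) neighbours(2)[OF assms] mixed_Int
    using card_parallels[OF assms] by (subst card_mixed) (simp_all add: finite_lines)
qed

lemma common_apex_vert:
  assumes "x \<in> pverts H"
  shows "card (parcs G `` {Apex} \<inter> parcs G `` {Vert x}) = q + 1"
proof -
  have "lines I \<inter> pencil x = pencil x" by (auto simp: pencil_def)
  then show ?thesis
    unfolding neighbours(1) neighbours(3)[OF assms] mixed_Int
    using card_pencil_H[OF assms] by (subst card_mixed) (simp_all add: finite_parts)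
qed

lemma pair_graph_G: "pair_graph G"
proof -
  have arcs: "fst e \<in> pverts G \<and> snd e \<in> pverts G \<and> prod.swap e \<in> parcs G \<and> fst e \<noteq> snd e"
    if "e \<in> parcs G" for e
  proof -
    obtain u w where "e = (u, w)" by (cases e)
    then show ?thesis using that A_subset A_symD A_irrefl parallel_sym
      by (cases u; cases w) (auto simp: arcs_G verts_G)
  qed
  have finite: "finite (pverts G)" by (simp add: verts_G mixed_def finite_lines finite_X)
  then have "finite (parcs G)"
    using arcs by (intro finite_subset[of "parcs G" "pverts G \<times> pverts G"]) (auto simp: mem_Times_iff)
  moreover have "symmetric (with_proj G)"
    using arcs by (force simp: symmetric_def intro: symI)
  ultimately show ?thesis using arcs finite by unfold_locales blast+
qed

theorem strongly_regular_G: "strongly_regular G (q^3 + q^2 + q + 1) (q^2 + q) (q - 1) (q + 1)"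
proof -
  have common: "card (parcs G `` {u} \<inter> parcs G `` {w}) = (if (u, w) \<in> parcs G then q - 1 else q + 1)"
    if "u \<in> pverts G" "w \<in> pverts G" "u \<noteq> w" for u w
    using that common_apex_line common_apex_vert common_line_line common_line_vert common_vert_vert
      Int_commute
    by (cases u; cases w) (auto simp: verts_G arcs_G Int_commute)
  have "card (pverts G) = q^3 + q^2 + q + 1"
    unfolding verts_G by (subst card_mixed) (simp_all add: finite_lines finite_X card_lines card_X)
  moreover have "card (parcs G `` {u}) = q^2 + q" if u: "u \<in> pverts G" for u
  proof (cases u)
    case Apex
    then show ?thesis unfolding Apex neighbours
      by (subst card_mixed) (simp_all add: finite_lines card_lines)
  next
    case (Line l)
    then have l: "l \<in> lines I" using u by (simp add: verts_G)
    have "l \<in> parallels l" using l by (simp add: parallel_def)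
    then show ?thesis unfolding Line neighbours(2)[OF l]
      using card_parallels[OF l] card_flags[OF l] order_ge_2
      by (subst card_mixed) (simp_all add: finite_parts power2_eq_square)
  next
    case (Vert x)
    then have x: "x \<in> pverts H" using u by (simp add: verts_G)
    show ?thesis unfolding Vert neighbours(3)[OF x]
      using card_pencil_H[OF x] degree[OF x] q_squares
      by (subst card_mixed) (simp_all add: finite_parts)
  qed
  moreover have "u \<noteq> w" if "(u, w) \<in> parcs G" for u w
    using that A_irrefl by (cases u; cases w) (auto simp: arcs_G)
  ultimately show ?thesis
    using common pair_graph_G unfolding strongly_regular_def by auto
qed

end

section \<open>The second subconstituent\<close>

text \<open>Nonadjacent vertices have common neighbours, so they are at distance two.\<close>

lemma second_subconstituent_eq:
  assumes srg: "strongly_regular G n k l m" and m: "0 < m" and v: "v \<in> pverts G"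
  defines "X \<equiv> {u \<in> pverts G. u \<noteq> v \<and> (v, u) \<notin> parcs G}"
  shows "second_subconstituent G v = \<lparr>pverts = X, parcs = parcs G \<inter> X \<times> X\<rparr>"
proof -
  interpret pair_graph G using srg by (simp add: strongly_regular_def)
  have "parcs G `` {v} \<inter> parcs G `` {u} \<noteq> {}" if "u \<in> pverts G" "u \<noteq> v" "(v, u) \<notin> parcs G" for u
  proof -
    have "card (parcs G `` {v} \<inter> parcs G `` {u}) = m"
      using srg that v unfolding strongly_regular_def by auto
    then show ?thesis using m by auto
  qed
  then have "{u \<in> pverts G. gdist G v u = 2} = X"
    unfolding X_def gdist_eq_2[OF v] by blast
  then show ?thesis by (simp add: second_subconstituent_def Let_def)
qed

lemma (in antipodal_cover) regular_pointI:
  assumes "v \<in> pverts G" "second_subconstituent G v = \<lparr>pverts = X, parcs = A\<rparr>"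
  shows "regular_point q G v"
  unfolding regular_point_def assms(2) Let_def
  using assms(1) generates_scheme_R first_eigenmatrix_R R_simps(2)
  by (intro conjI exI[of _ R]) simp_all

lemma regular_point_imp_antipodal_cover:
  assumes "2 \<le> q" "regular_point q G v" "second_subconstituent G v = \<lparr>pverts = X, parcs = A\<rparr>"
  obtains S where "antipodal_cover q X A S"
proof -
  obtain R where "R 1 = A" "generates_scheme (rel_mat A) X 3 R"
    "first_eigenmatrix X 3 R (regular_point_matrix (real q))"
    using assms(2) unfolding regular_point_def assms(3) Let_def by auto
  then show ?thesis
    using that scheme_imp_antipodal_cover[OF assms(1), of X R] by (auto simp: generates_scheme_def)
qed

section \<open>Recovering the cover and the plane\<close>

lemma finite_inj_on_infinite:
  assumes "finite A"
  obtains f :: "'a \<Rightarrow> 'b :: infinite" where "inj_on f A"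
proof -
  obtain B :: "'b set" where B: "finite B" "card B = card A"
    using infinite_arbitrarily_large[OF infinite_UNIV] by metis
  then show ?thesis using that finite_same_card_bij[OF assms B(1)] by (auto simp: bij_betw_def)
qed

text \<open>
  Here \<open>X\<close> is the vertex set of the second subconstituent of \<open>v\<close>, which is assumed to be a cover.
\<close>

locale srg_with_cover = pair_graph G + antipodal_cover q X A S
  for q :: nat and G :: "'a pair_pre_digraph" and v :: 'a and X :: "'a set" and A S :: "'a rel" +
  assumes srg: "strongly_regular G (q^3 + q^2 + q + 1) (q^2 + q) (q - 1) (q + 1)"
    and v: "v \<in> pverts G"
    and X_eq: "X = {u \<in> pverts G. u \<noteq> v \<and> (v, u) \<notin> parcs G}"
    and A_eq: "A = parcs G \<inter> X \<times> X"
begin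

definition L :: "'a set" where
  "L = parcs G `` {v}"

lemma verts_split: "pverts G = insert v (L \<union> X)" "v \<notin> L" "v \<notin> X" "L \<inter> X = {}"
  using v no_loop wellformed' by (auto simp: L_def X_eq)

lemma valency: "u \<in> pverts G \<Longrightarrow> card (parcs G `` {u}) = q^2 + q"
  using srg by (simp add: strongly_regular_def)

lemma common_adjacent:
  "(u, w) \<in> parcs G \<Longrightarrow> card (parcs G `` {u} \<inter> parcs G `` {w}) = q - 1"
  using srg wellformed' by (simp add: strongly_regular_def)

lemma common_nonadjacent:
  "u \<in> pverts G \<Longrightarrow> w \<in> pverts G \<Longrightarrow> u \<noteq> w \<Longrightarrow> (u, w) \<notin> parcs G \<Longrightarrow>
     card (parcs G `` {u} \<inter> parcs G `` {w}) = q + 1"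
  using srg by (simp add: strongly_regular_def)

lemma no_arc_v_X: "x \<in> X \<Longrightarrow> (v, x) \<notin> parcs G \<and> (x, v) \<notin> parcs G"
  using arc_sym by (auto simp: X_eq)

lemma neighbours_split:
  assumes "x \<in> X"
  shows "parcs G `` {x} = (parcs G `` {x} \<inter> L) \<union> A `` {x}"
proof (intro subset_antisym subsetI)
  fix z assume z: "z \<in> parcs G `` {x}"
  then have "z \<in> pverts G" "z \<noteq> v" using wellformed' no_arc_v_X[OF assms] by auto
  then show "z \<in> (parcs G `` {x} \<inter> L) \<union> A `` {x}" using z assms verts_split(1) by (auto simp: A_eq)
qed (auto simp: A_eq)

lemma card_common_split:
  assumes x: "x \<in> X" and y: "y \<in> X"
  shows "card (parcs G `` {x} \<inter> parcs G `` {y}) =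
    card (parcs G `` {x} \<inter> parcs G `` {y} \<inter> L) + card (A `` {x} \<inter> A `` {y})"
proof -
  have "parcs G `` {x} \<inter> parcs G `` {y} =
      (parcs G `` {x} \<inter> parcs G `` {y} \<inter> L) \<union> (A `` {x} \<inter> A `` {y})"
    using neighbours_split[OF x] neighbours_split[OF y] verts_split(4) A_subset by blast
  moreover have "(parcs G `` {x} \<inter> parcs G `` {y} \<inter> L) \<inter> (A `` {x} \<inter> A `` {y}) = {}"
    using verts_split(4) A_subset by blast
  ultimately show ?thesis
    using card_Un_disjoint[of "parcs G `` {x} \<inter> parcs G `` {y} \<inter> L" "A `` {x} \<inter> A `` {y}"]
    by (simp add: finite_neighbours finite_A_Image)
qed

lemma card_lines_at: "x \<in> X \<Longrightarrow> card (parcs G `` {x} \<inter> L) = q + 1"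
  using common_nonadjacent[of x v] no_arc_v_X[of x] v verts_split(1,3) by (auto simp: L_def)

text \<open>
  Two vertices of one fibre have no common neighbour in the cover, so all their \<open>q + 1\<close> common
  neighbours are adjacent to \<open>v\<close>, which is as many as either has there.
\<close>

lemma same_lines:
  assumes xy: "(x, y) \<in> S"
  shows "parcs G `` {x} \<inter> L = parcs G `` {y} \<inter> L"
proof (cases "x = y")
  case False
  have X: "x \<in> X" "y \<in> X" using xy S_subset by auto
  have "(x, y) \<notin> parcs G" using xy X A_S_disjoint by (auto simp: A_eq)
  then have card: "card (parcs G `` {x} \<inter> parcs G `` {y} \<inter> L) = q + 1"
    using common_nonadjacent[of x y] X False verts_split(1) card_common_split[OF X]
      fibre_common[OF xy False] by auto
  have "parcs G `` {x} \<inter> parcs G `` {y} \<inter> L = parcs G `` {x} \<inter> L"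
    by (rule card_subset_eq) (use card card_lines_at[OF X(1)] in \<open>auto simp: finite_neighbours\<close>)
  moreover have "parcs G `` {x} \<inter> parcs G `` {y} \<inter> L = parcs G `` {y} \<inter> L"
    by (rule card_subset_eq) (use card card_lines_at[OF X(2)] in \<open>auto simp: finite_neighbours\<close>)
  ultimately show ?thesis by simp
qed simp

text \<open>
  Vertices of different fibres have one common neighbour fewer in the cover than in \<open>G\<close>, whether or
  not they are adjacent: \<open>q - 2\<close> against \<open>q - 1\<close>, or \<open>q\<close> against \<open>q + 1\<close>.
\<close>

lemma one_common_line:
  assumes X: "x \<in> X" "y \<in> X" and xy: "(x, y) \<notin> S"
  shows "card (parcs G `` {x} \<inter> parcs G `` {y} \<inter> L) = 1"
proof (cases "(x, y) \<in> A")
  case True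
  then have "(x, y) \<in> parcs G" by (simp add: A_eq)
  then show ?thesis
    using common_adjacent card_common_split[OF X] adjacent_common[OF True] q_ge_2 by fastforce
next
  case False
  then have "(x, y) \<notin> parcs G" using X by (simp add: A_eq)
  moreover have "x \<noteq> y" using xy S_refl[OF X(1)] by auto
  ultimately show ?thesis
    using common_nonadjacent[of x y] card_common_split[OF X] distance_2_common[OF X False xy]
      X verts_split(1) by auto
qed

lemma card_L_neighbours:
  assumes "l \<in> L"
  shows "card (parcs G `` {l} \<inter> L) = q - 1"
  using common_adjacent[of v l] assms by (simp add: L_def Int_commute)

lemma card_X_neighbours:
  assumes l: "l \<in> L"
  shows "card (parcs G `` {l} \<inter> X) = q * q"
proof -
  have lv: "l \<in> pverts G" using l verts_split by auto
  have "parcs G `` {l} = insert v ((parcs G `` {l} \<inter> L) \<union> (parcs G `` {l} \<inter> X))"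
  proof (intro subset_antisym subsetI)
    fix z assume z: "z \<in> parcs G `` {l}"
    then have "z \<in> pverts G" using wellformed' by blast
    then show "z \<in> insert v ((parcs G `` {l} \<inter> L) \<union> (parcs G `` {l} \<inter> X))"
      using z unfolding verts_split(1) by blast
  next
    fix z assume "z \<in> insert v ((parcs G `` {l} \<inter> L) \<union> (parcs G `` {l} \<inter> X))"
    moreover have "(l, v) \<in> parcs G" using l arc_sym by (simp add: L_def)
    ultimately show "z \<in> parcs G `` {l}" by blast
  qed
  then have "card (parcs G `` {l}) = card (insert v ((parcs G `` {l} \<inter> L) \<union> (parcs G `` {l} \<inter> X)))"
    by simp
  also have "\<dots> = Suc (card ((parcs G `` {l} \<inter> L) \<union> (parcs G `` {l} \<inter> X)))"
    using verts_split(2,3) by (intro card_insert_disjoint) (auto simp: finite_neighbours)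
  also have "\<dots> = Suc (card (parcs G `` {l} \<inter> L) + card (parcs G `` {l} \<inter> X))"
    using verts_split(4) by (subst card_Un_disjoint) (auto simp: finite_neighbours)
  finally show ?thesis
    using valency[OF lv] card_L_neighbours[OF l] q_ge_2 by (simp add: power2_eq_square)
qed

text \<open>
  The lines are the neighbours of \<open>v\<close>, the points are the fibres, and a line is incident with a fibre
  if it is adjacent to one and hence, by \<open>same_lines\<close>, to all of its vertices. Two fibres share one
  neighbour of \<open>v\<close>, and counting gives \<open>q\<close> fibres on each line: this is the design of a plane. The
  cover and the plane live in types of their own, so the parts of \<open>G\<close> are copied along injections.
\<close>

lemma recover:
  fixes g :: "'a \<Rightarrow> 'h" and \<phi> :: "'h set \<Rightarrow> 'p" and \<psi> :: "'a \<Rightarrow> 'l"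
  assumes g: "inj_on g X" and \<psi>: "inj_on \<psi> L"
  defines "H \<equiv> \<lparr>pverts = g ` X, parcs = map_prod g g ` A\<rparr>"
  assumes \<phi>: "inj_on \<phi> (fibres H)"
  defines "p \<equiv> \<lambda>x. \<phi> (antipodal_rel H `` {g x})"
  defines "I \<equiv> \<lparr>points = p ` X, lines = \<psi> ` L,
     inc = \<lambda>t k. \<exists>x\<in>X. \<exists>l\<in>L. t = p x \<and> k = \<psi> l \<and> (l, x) \<in> parcs G\<rparr>"
  shows "distance_regular H [q^2 - 1, q^2 - q, 1] [1, q, q^2 - 1]"
    and "affine_plane_of_order I q"
    and "bij_betw \<phi> (fibres H) (points I)"
    and "digraph_iso (with_proj G) (with_proj (cover_plane_graph H I \<phi>))"
proof -
  let ?S = "map_prod g g ` S"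
  have cover: "antipodal_cover q (pverts H) (parcs H) ?S"
    using antipodal_cover_image[OF antipodal_cover_axioms g] by (simp add: H_def)
  interpret C: antipodal_cover q "pverts H" "parcs H" ?S by (rule cover)
  have pair: "pair_graph H"
  proof
    show "finite (parcs H)"
      using C.finite_X by (intro finite_subset[OF C.A_subset]) simp
    show "symmetric (with_proj H)" using C.sym_A by (simp add: symmetric_def)
  qed (use C.A_subset C.A_irrefl C.finite_X in auto)
  show "distance_regular H [q^2 - 1, q^2 - q, 1] [1, q, q^2 - 1]"
    by (rule antipodal_cover_imp_distance_regular(1)[OF pair cover])
  have anti: "antipodal_rel H = ?S"
    by (rule antipodal_cover_imp_distance_regular(2)[OF pair cover])
  have fib: "fibres H = (\<lambda>x. antipodal_rel H `` {g x}) ` X"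
    by (auto simp: fibres_def quotient_def H_def)
  show bij: "bij_betw \<phi> (fibres H) (points I)"
    using \<phi> by (simp add: bij_betw_def I_def fib p_def image_image)
  have p_eq: "p x = p y \<longleftrightarrow> (x, y) \<in> S" if "x \<in> X" "y \<in> X" for x y
  proof -
    have gX: "g x \<in> pverts H" "g y \<in> pverts H" using that by (simp_all add: H_def)
    have "p x = p y \<longleftrightarrow> antipodal_rel H `` {g x} = antipodal_rel H `` {g y}"
      unfolding p_def using that by (intro inj_on_eq_iff[OF \<phi>]) (auto simp: fib)
    also have "\<dots> \<longleftrightarrow> (g x, g y) \<in> ?S"
      unfolding anti by (rule eq_equiv_class_iff[OF C.equiv_S gX])
    also have "\<dots> \<longleftrightarrow> (x, y) \<in> S" by (rule map_prod_in_image_iff[OF g S_subset that])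
    finally show ?thesis .
  qed
  have inc_iff: "inc I (p x) (\<psi> l) \<longleftrightarrow> (l, x) \<in> parcs G" if x: "x \<in> X" and l: "l \<in> L" for x l
  proof
    assume "inc I (p x) (\<psi> l)"
    then obtain y m where y: "y \<in> X" "m \<in> L" "p x = p y" "\<psi> l = \<psi> m" "(m, y) \<in> parcs G"
      by (auto simp: I_def)
    then have "l = m" using inj_onD[OF \<psi>] l by blast
    then have "l \<in> parcs G `` {y} \<inter> L" using y arc_sym by auto
    then have "l \<in> parcs G `` {x} \<inter> L" using same_lines[of x y] p_eq[OF x y(1)] y(3) by simp
    then show "(l, x) \<in> parcs G" using arc_sym by auto
  qed (use x l in \<open>auto simp: I_def\<close>)
  have sub: "parcs G `` {l} \<inter> X = {x \<in> X. p x \<in> {t \<in> p ` X. inc I t (\<psi> l)}}" if "l \<in> L" for l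
    using inc_iff[OF _ that] by auto
  have design: "plane_design q I"
  proof
    show "2 \<le> q" by (rule q_ge_2)
    show "finite (points I)" using finite_X by (simp add: I_def)
    show "card (points I) = q^2" using card_points(3)[OF p_eq] by (simp add: I_def)
  next
    fix k assume "k \<in> lines I"
    then obtain l where l: "l \<in> L" "k = \<psi> l" by (auto simp: I_def)
    have "q * q = q * card {t \<in> p ` X. inc I t k}"
      using card_over_points[OF p_eq, of "{t \<in> p ` X. inc I t k}"] card_X_neighbours[OF l(1)]
      unfolding sub[OF l(1)] l(2) by auto
    then show "card {t \<in> points I. inc I t k} = q" using q_ge_2 by (simp add: I_def)
  next
    fix s t assume st: "s \<in> points I" "t \<in> points I" "s \<noteq> t"
    then obtain x y where x: "x \<in> X" "s = p x" and y: "y \<in> X" "t = p y" by (auto simp: I_def)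
    have "(x, y) \<notin> S" using p_eq[OF x(1) y(1)] st(3) x(2) y(2) by simp
    then have "card {l. l \<in> parcs G `` {x} \<inter> parcs G `` {y} \<inter> L} = 1"
      unfolding Collect_mem_eq by (rule one_common_line[OF x(1) y(1)])
    then have "\<exists>!l. l \<in> parcs G `` {x} \<inter> parcs G `` {y} \<inter> L"
      unfolding card_eq_1_iff_unique .
    then obtain l where l: "l \<in> parcs G `` {x} \<inter> parcs G `` {y} \<inter> L"
      and uniq: "\<And>m. m \<in> parcs G `` {x} \<inter> parcs G `` {y} \<inter> L \<Longrightarrow> m = l" by auto
    show "\<exists>!k. k \<in> lines I \<and> inc I s k \<and> inc I t k"
    proof (rule ex1I[of _ "\<psi> l"])
      show "\<psi> l \<in> lines I \<and> inc I s (\<psi> l) \<and> inc I t (\<psi> l)"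
        using l x y arc_sym inc_iff by (auto simp: I_def)
      fix k assume k: "k \<in> lines I \<and> inc I s k \<and> inc I t k"
      then obtain m where m: "m \<in> L" "k = \<psi> m" by (auto simp: I_def)
      then have "(m, x) \<in> parcs G" "(m, y) \<in> parcs G" using k x y inc_iff by auto
      then show "k = \<psi> l" using uniq[of m] m arc_sym by auto
    qed
  qed
  interpret P: plane_design q I by (rule design)
  show "affine_plane_of_order I q" by (rule P.affine_plane)
  interpret W: cover_with_plane q H I \<phi>
    by (intro cover_with_plane.intro cover_with_plane_axioms.intro) (use cover anti design bij in auto)
  have lines: "lines I = \<psi> ` L" by (simp add: I_def)
  have point: "W.point (g x) = p x" for x by (simp add: W.point_def p_def)
  \<comment> \<open>Adjacent neighbours of \<open>v\<close> share \<open>v\<close> and \<open>q - 2\<close> more common neighbours, too few for a fibre.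
    So adjacency implies parallelism, and both leave \<open>q - 1\<close> choices.\<close>
  have parallel_iff: "l \<noteq> m \<and> parallel I (\<psi> l) (\<psi> m) \<longleftrightarrow> (l, m) \<in> parcs G"
    if l: "l \<in> L" and m: "m \<in> L" for l m
  proof -
    let ?N = "parcs G `` {l} \<inter> L" and ?M = "{m \<in> L. l \<noteq> m \<and> parallel I (\<psi> l) (\<psi> m)}"
    have "?N \<subseteq> ?M"
    proof
      fix m assume "m \<in> ?N"
      then have m: "m \<in> L" "(l, m) \<in> parcs G" by auto
      have "parallel I (\<psi> l) (\<psi> m)"
      proof (rule ccontr)
        assume "\<not> ?thesis"
        then obtain t where t: "t \<in> points I" "inc I t (\<psi> l)" "inc I t (\<psi> m)" by (auto simp: parallel_def)
        then have "{x \<in> X. p x = t} \<subseteq> parcs G `` {l} \<inter> parcs G `` {m}"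
          using inc_iff l m by auto
        then have "card {x \<in> X. p x = t} \<le> card (parcs G `` {l} \<inter> parcs G `` {m})"
          by (intro card_mono) (auto simp: finite_neighbours)
        moreover have "card {x \<in> X. p x = t} = q"
          using card_fibre_of_point[OF p_eq, of t] t by (simp add: I_def)
        ultimately show False using common_adjacent[OF m(2)] q_ge_2 by simp
      qed
      then show "m \<in> ?M" using m no_loop by auto
    qed
    moreover have "card ?M = q - 1"
    proof -
      have img: "\<psi> ` ?M = P.parallels (\<psi> l) - {\<psi> l}"
        using inj_on_eq_iff[OF \<psi>] l by (auto simp: lines)
      have "inj_on \<psi> ?M" by (rule inj_on_subset[OF \<psi>]) auto
      from card_image[OF this] have "card ?M = card (P.parallels (\<psi> l) - {\<psi> l})"
        unfolding img by (rule sym)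
      moreover have "\<psi> l \<in> P.parallels (\<psi> l)" using l by (simp add: lines parallel_def)
      moreover have "card (P.parallels (\<psi> l)) = q" by (rule P.card_parallels) (simp add: lines l)
      ultimately show ?thesis by (simp only: card_Diff_singleton)
    qed
    ultimately have "?N = ?M"
      using card_L_neighbours[OF l] pair_finite_verts verts_split(1)
      by (intro card_subset_eq) auto
    then show ?thesis using m by blast
  qed
  define F where "F u = (if u = v then Apex else if u \<in> L then Line (\<psi> u) else Vert (g u))" for u
  have F: "F v = Apex" "\<And>l. l \<in> L \<Longrightarrow> F l = Line (\<psi> l)" "\<And>x. x \<in> X \<Longrightarrow> F x = Vert (g x)"
    using verts_split by (auto simp: F_def)
  have inj: "inj_on F (pverts G)"
    unfolding verts_split(1)
    by (rule inj_onI) (use F inj_onD[OF g] inj_onD[OF \<psi>] in \<open>auto\<close>)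
  have img: "pverts (cover_plane_graph H I \<phi>) = F ` pverts G"
    unfolding verts_split(1) image_insert image_Un F(1)
    using F(2,3) by (force simp: cover_plane_graph_def lines H_def)
  have arcs: "(F a, F b) \<in> parcs (cover_plane_graph H I \<phi>) \<longleftrightarrow> (a, b) \<in> parcs G"
    if "a \<in> pverts G" "b \<in> pverts G" for a b
  proof -
    have inj_g: "(g x, g y) \<in> parcs H \<longleftrightarrow> (x, y) \<in> parcs G" if "x \<in> X" "y \<in> X" for x y
      using map_prod_in_image_iff[OF g A_subset that] that by (simp add: H_def A_eq)
    have gX: "g x \<in> pverts H" if "x \<in> X" for x using that by (simp add: H_def)
    have LX: "(Line (\<psi> l), Vert (g x)) \<in> parcs W.G \<longleftrightarrow> (l, x) \<in> parcs G"
      "(Vert (g x), Line (\<psi> l)) \<in> parcs W.G \<longleftrightarrow> (x, l) \<in> parcs G" if "l \<in> L" "x \<in> X" for l x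
      using that gX[OF that(2)] inc_iff[OF that(2,1)] arc_sym by (auto simp: W.arcs_G point lines)
    have LL: "(Line (\<psi> l), Line (\<psi> m)) \<in> parcs W.G \<longleftrightarrow> (l, m) \<in> parcs G" if "l \<in> L" "m \<in> L" for l m
      using that parallel_iff[OF that] inj_on_eq_iff[OF \<psi> that] by (auto simp: W.arcs_G lines)
    have vL: "(v, l) \<in> parcs G" "(l, v) \<in> parcs G" "\<psi> l \<in> lines I" if "l \<in> L" for l
      using that arc_sym by (auto simp: L_def lines)
    have "a = v \<or> a \<in> L \<or> a \<in> X" "b = v \<or> b \<in> L \<or> b \<in> X" using that verts_split(1) by auto
    then show ?thesis
      using F LX LL vL no_loop[of v] no_arc_v_X inj_g
      by (elim disjE) (simp_all add: W.arcs_G)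
  qed
  have "parcs (cover_plane_graph H I \<phi>) = map_prod F F ` parcs G"
  proof (intro subset_antisym subsetI)
    interpret W': pair_graph W.G by (rule W.pair_graph_G)
    fix e assume e: "e \<in> parcs (cover_plane_graph H I \<phi>)"
    then obtain a b where "a \<in> pverts G" "b \<in> pverts G" "e = (F a, F b)"
      using W'.wellformed' img by (cases e) blast
    then show "e \<in> map_prod F F ` parcs G" using e arcs by force
  next
    fix e assume "e \<in> map_prod F F ` parcs G"
    then obtain a b where "(a, b) \<in> parcs G" "e = (F a, F b)" by auto
    then show "e \<in> parcs (cover_plane_graph H I \<phi>)" using arcs wellformed' by blast
  qed
  then show "digraph_iso (with_proj G) (with_proj (cover_plane_graph H I \<phi>))"
    unfolding digraph_iso_with_proj_iff using pair_wf_digraph inj img by blast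
qed

end

section \<open>The characterization\<close>

lemma srg_imp_cover_plane_graph:
  fixes \<Gamma> :: "'a pair_pre_digraph"
  assumes q: "2 \<le> q" and srg: "strongly_regular \<Gamma> (q^3 + q^2 + q + 1) (q^2 + q) (q - 1) (q + 1)"
    and reg: "regular_point q \<Gamma> v"
  shows "\<exists>(H :: 'h::infinite pair_pre_digraph) (I :: ('p::infinite, 'l::infinite) incidence_structure)
      (\<phi> :: 'h set \<Rightarrow> 'p).
    distance_regular H [q^2 - 1, q^2 - q, 1] [1, q, q^2 - 1] \<and> affine_plane_of_order I q \<and>
    bij_betw \<phi> (fibres H) (points I) \<and>
    digraph_iso (with_proj \<Gamma>) (with_proj (cover_plane_graph H I \<phi>))"
proof -
  interpret pair_graph \<Gamma> using srg by (simp add: strongly_regular_def)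
  define X where "X = {u \<in> pverts \<Gamma>. u \<noteq> v \<and> (v, u) \<notin> parcs \<Gamma>}"
  define A where "A = parcs \<Gamma> \<inter> X \<times> X"
  have v: "v \<in> pverts \<Gamma>" using reg by (simp add: regular_point_def)
  have D: "second_subconstituent \<Gamma> v = \<lparr>pverts = X, parcs = A\<rparr>"
    unfolding A_def X_def by (rule second_subconstituent_eq[OF srg _ v]) simp
  obtain S where cover: "antipodal_cover q X A S"
    by (rule regular_point_imp_antipodal_cover[OF q reg D])
  have "pair_graph \<Gamma>" using srg by (simp add: strongly_regular_def)
  then interpret srg_with_cover q \<Gamma> v X A S
    by (intro srg_with_cover.intro srg_with_cover_axioms.intro cover srg v X_def A_def)
  have "finite L" using finite_neighbours by (simp add: L_def)
  then obtain \<psi> :: "'a \<Rightarrow> 'l" where \<psi>: "inj_on \<psi> L" by (rule finite_inj_on_infinite)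
  obtain g :: "'a \<Rightarrow> 'h" where g: "inj_on g X" using finite_X by (rule finite_inj_on_infinite)
  define H where "H = \<lparr>pverts = g ` X, parcs = map_prod g g ` A\<rparr>"
  have "finite (fibres H)"
    unfolding fibres_def H_def using finite_X by (intro finite_quotient) (auto simp: antipodal_rel_def)
  then obtain \<phi> :: "'h set \<Rightarrow> 'p" where \<phi>: "inj_on \<phi> (fibres H)" by (rule finite_inj_on_infinite)
  from recover[OF g \<psi> \<phi>[unfolded H_def]] show ?thesis by blast
qed

lemma cover_plane_graph_imp_srg:
  assumes q: "2 \<le> q" and "pair_graph \<Gamma>"
    and dr: "distance_regular H [q^2 - 1, q^2 - q, 1] [1, q, q^2 - 1]"
    and plane: "affine_plane_of_order I q" and bij: "bij_betw \<phi> (fibres H) (points I)"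
    and iso: "digraph_iso (with_proj \<Gamma>) (with_proj (cover_plane_graph H I \<phi>))"
  shows "strongly_regular \<Gamma> (q^3 + q^2 + q + 1) (q^2 + q) (q - 1) (q + 1) \<and>
    (\<exists>v. regular_point q \<Gamma> v)"
proof -
  interpret pair_graph \<Gamma> by fact
  have cover: "antipodal_cover q (pverts H) (parcs H) (antipodal_rel H)"
    by (rule distance_regular_imp_antipodal_cover[OF q dr])
  interpret C: antipodal_cover q "pverts H" "parcs H" "antipodal_rel H" by (rule cover)
  have fib: "fibres H = (\<lambda>x. antipodal_rel H `` {x}) ` pverts H"
    by (auto simp: fibres_def quotient_def)
  have "card (fibres H) = q^2"
    unfolding fib by (rule C.card_points(3)) (rule eq_equiv_class_iff[OF C.equiv_S])
  then have "card (points I) = q^2" using bij_betw_same_card[OF bij] by simp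
  moreover have "finite (points I)"
    using bij_betw_finite[OF bij] C.finite_X by (simp add: fib)
  ultimately have "plane_design q I" using plane q by (intro plane_design_of_affine_plane) auto
  then interpret W: cover_with_plane q H I \<phi>
    by (intro cover_with_plane.intro cover_with_plane_axioms.intro cover bij)
  obtain F where F: "inj_on F (pverts \<Gamma>)" and V: "pverts W.G = F ` pverts \<Gamma>"
    and E: "parcs W.G = map_prod F F ` parcs \<Gamma>"
    using iso unfolding digraph_iso_with_proj_iff by blast
  have srg: "strongly_regular \<Gamma> (q^3 + q^2 + q + 1) (q^2 + q) (q - 1) (q + 1)"
    by (rule strongly_regular_reflect_iso[OF W.strongly_regular_G \<open>pair_graph \<Gamma>\<close> F V E])
  have E_sub: "parcs \<Gamma> \<subseteq> pverts \<Gamma> \<times> pverts \<Gamma>" by (auto dest: wellformed')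
  have arcs: "(F a, F b) \<in> parcs W.G \<longleftrightarrow> (a, b) \<in> parcs \<Gamma>" if "a \<in> pverts \<Gamma>" "b \<in> pverts \<Gamma>" for a b
    unfolding E by (rule map_prod_in_image_iff[OF F E_sub that])
  have "Apex \<in> pverts W.G" by (simp add: W.verts_G)
  then obtain v where v: "v \<in> pverts \<Gamma>" "F v = Apex" using V by auto
  define g where "g h = inv_into (pverts \<Gamma>) F (Vert h)" for h
  have Fg: "F (g h) = Vert h" "g h \<in> pverts \<Gamma>" if "h \<in> pverts H" for h
  proof -
    have "Vert h \<in> pverts W.G" using that by (simp add: W.verts_G)
    then have "Vert h \<in> F ` pverts \<Gamma>" by (simp only: V)
    then show "F (g h) = Vert h" "g h \<in> pverts \<Gamma>"
      unfolding g_def by (rule f_inv_into_f, rule inv_into_into)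
  qed
  have g: "inj_on g (pverts H)" by (rule inj_onI) (metis Fg(1) cover_vertex.inject(2))
  have X: "g ` pverts H = {u \<in> pverts \<Gamma>. u \<noteq> v \<and> (v, u) \<notin> parcs \<Gamma>}"
  proof (intro subset_antisym subsetI)
    fix u assume "u \<in> g ` pverts H"
    then obtain h where h: "h \<in> pverts H" "u = g h" by auto
    then show "u \<in> {u \<in> pverts \<Gamma>. u \<noteq> v \<and> (v, u) \<notin> parcs \<Gamma>}"
      using Fg[OF h(1)] v arcs[of v u] by (auto simp: W.arcs_G)
  next
    fix u assume u: "u \<in> {u \<in> pverts \<Gamma>. u \<noteq> v \<and> (v, u) \<notin> parcs \<Gamma>}"
    then have Fu: "F u \<in> pverts W.G" "F u \<noteq> Apex" "(Apex, F u) \<notin> parcs W.G"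
      using V v inj_onD[OF F, of u v] arcs[of v u] by auto
    then obtain h where h: "h \<in> pverts H" "F u = Vert h"
      by (cases "F u") (auto simp: W.verts_G W.arcs_G)
    then have "u = g h" using u Fg[OF h(1)] by (intro inj_onD[OF F]) auto
    then show "u \<in> g ` pverts H" using h by blast
  qed
  have A: "map_prod g g ` parcs H = parcs \<Gamma> \<inter> g ` pverts H \<times> g ` pverts H"
  proof -
    have gg: "(g x, g y) \<in> parcs \<Gamma> \<longleftrightarrow> (x, y) \<in> parcs H" if "x \<in> pverts H" "y \<in> pverts H" for x y
      using arcs[of "g x" "g y"] Fg that by (simp add: W.arcs_G)
    show ?thesis
    proof (intro subset_antisym subsetI)
      fix e assume "e \<in> map_prod g g ` parcs H"
      then obtain x y where xy: "(x, y) \<in> parcs H" "e = (g x, g y)" by auto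
      then show "e \<in> parcs \<Gamma> \<inter> g ` pverts H \<times> g ` pverts H"
        using gg[of x y] C.A_subset by auto
    next
      fix e assume "e \<in> parcs \<Gamma> \<inter> g ` pverts H \<times> g ` pverts H"
      then obtain x y where "x \<in> pverts H" "y \<in> pverts H" "e = (g x, g y)" "e \<in> parcs \<Gamma>" by auto
      then show "e \<in> map_prod g g ` parcs H" using gg[of x y] by force
    qed
  qed
  interpret D: antipodal_cover q "g ` pverts H" "map_prod g g ` parcs H" "map_prod g g ` antipodal_rel H"
    by (rule antipodal_cover_image[OF cover g])
  have "second_subconstituent \<Gamma> v = \<lparr>pverts = g ` pverts H, parcs = map_prod g g ` parcs H\<rparr>"
    unfolding A unfolding X by (rule second_subconstituent_eq[OF srg _ v(1)]) simp
  then have "regular_point q \<Gamma> v" by (rule D.regular_pointI[OF v(1)])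
  with srg show ?thesis by blast
qed

theorem corollary4p1:
  fixes q :: nat and \<Gamma> :: "'a pair_pre_digraph"
  assumes "q \<ge> 2" and "pair_graph \<Gamma>"
  shows "strongly_regular \<Gamma> (q^3 + q^2 + q + 1) (q^2 + q) (q - 1) (q + 1) \<and>
           (\<exists>v. regular_point q \<Gamma> v)
     \<longleftrightarrow> (\<exists>(H :: 'h::infinite pair_pre_digraph)
             (I :: ('p::infinite, 'l::infinite) incidence_structure)
             (\<phi> :: 'h set \<Rightarrow> 'p).
           distance_regular H [q^2 - 1, q^2 - q, 1] [1, q, q^2 - 1] \<and>
           affine_plane_of_order I q \<and>
           bij_betw \<phi> (fibres H) (points I) \<and>
           digraph_iso (with_proj \<Gamma>) (with_proj (cover_plane_graph H I \<phi>)))"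
proof (rule iffI, goal_cases)
  case 1
  then show ?case by (elim conjE exE) (rule srg_imp_cover_plane_graph[OF assms(1)])
next
  case 2
  then show ?case by (elim conjE exE) (rule cover_plane_graph_imp_srg[OF assms])
qed

end
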